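(* Let $f\not\equiv0$ be a meromorphic function on $\mathbb{C}$. Then for every $\gamma>1$, there exists a constant $B_\gamma$ depending only on $\gamma$, such that for almost every $\theta\in[-\pi,\pi)$, $$\left|\frac{(\mathcal{D}_{\mathrm{W}}f)(re^{i\theta})}{f(re^{i\theta})}\right|\le2\exp\left(B_\gamma\left\{\frac{T(\gamma r,f)}{\sqrt r}+\frac{n(\gamma r)}{\sqrt r}(\ln r)^\gamma\ln^+[n(\gamma r)]\right\}\right)$$ for every sufficiently large $r$. In particular, if $f$ is of finite order $\sigma$, then for every positive integer $k$, every $\varepsilon>0$ and almost every $\theta\in[-\pi,\pi)$, $$\left|\frac{(\mathcal{D}_{\mathrm{W}}^kf)(re^{i\theta})}{f(re^{i\theta})}\right|\le e^{kr^{\sigma-\frac12+\varepsilon}}$$ for every sufficiently large $r$.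
   Context: The Wilson operator $\mathcal{D}_{\mathrm{W}}$: for $x\ne0$ and $z$ with $z^2=x$, $$(\mathcal{D}_{\mathrm{W}}f)(x):=\frac{f((z+\frac i2)^2)-f((z-\frac i2)^2)}{2iz},$$ which does not depend on the choice of $z$; at $x=0$ the value is the limit as $x\to0$, which is $f'(-\frac14)$ if $f$ is differentiable at $-\frac14$. If $f$ is meromorphic on $\mathbb{C}$, so is $\mathcal{D}_{\mathrm{W}}f$; $\mathcal{D}_{\mathrm{W}}^k$ is the $k$-fold iterate. $n(r):=n(r,f)+n(r,\frac1f)$ is the number of poles plus the number of zeros of $f$ in $|x|\le r$, counted with multiplicity. $T(r,f)$ is the Nevanlinna characteristic; the order of $f$ is $\limsup_{r\to\infty}\frac{\ln^+T(r,f)}{\ln r}$. "Almost every" refers to Lebesgue measure; "sufficiently large" may depend on $\theta$. *)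

theory Defs
  imports "HOL-Complex_Analysis.Complex_Analysis"
begin

section \<open>The Wilson operator\<close>

definition wilson_quotient :: "(complex \<Rightarrow> complex) \<Rightarrow> complex \<Rightarrow> complex" where
  "wilson_quotient f z = (f ((z + \<i> / 2)\<^sup>2) - f ((z - \<i> / 2)\<^sup>2)) / (2 * \<i> * z)"

text \<open>
  The choice of the square root is irrelevant, see \<open>wilson_square\<close> below. The definition is
  pointwise: where \<open>f\<close> has a pole at one of the two shifted points, the value is the one obtained
  from the (arbitrary) value of \<open>f\<close> there and has no meaning. For meromorphic \<open>f\<close> and any number of
  iterations, the points affected by this form a countable set.
\<close>

definition wilson :: "(complex \<Rightarrow> complex) \<Rightarrow> complex \<Rightarrow> complex" where
  "wilson f x =
     (if x = 0 then Lim (at 0) (\<lambda>y. wilson_quotient f (csqrt y))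
      else wilson_quotient f (csqrt x))"

lemma wilson_quotient_minus: "wilson_quotient f (- z) = wilson_quotient f z"
proof -
  have "(- z + \<i> / 2)\<^sup>2 = (z - \<i> / 2)\<^sup>2" "(- z - \<i> / 2)\<^sup>2 = (z + \<i> / 2)\<^sup>2"
    by (simp_all add: power2_eq_square algebra_simps)
  then show ?thesis
    unfolding wilson_quotient_def by (simp add: divide_simps)
qed

lemma wilson_square:
  assumes "x \<noteq> 0" "z\<^sup>2 = x"
  shows "wilson f x = (f ((z + \<i> / 2)\<^sup>2) - f ((z - \<i> / 2)\<^sup>2)) / (2 * \<i> * z)"
proof -
  have "csqrt x = z \<or> csqrt x = - z"
    using assms power2_csqrt power2_eq_iff by metis
  then have "wilson f x = wilson_quotient f z"
    using assms wilson_quotient_minus[of f z] by (auto simp: wilson_def)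
  then show ?thesis
    by (simp add: wilson_quotient_def)
qed

lemma wilson_zero:
  assumes "f field_differentiable at (- 1 / 4)"
  shows "wilson f 0 = deriv f (- 1 / 4)"
proof -
  let ?a = "- 1 / 4 :: complex"
  have "(f has_field_derivative deriv f ?a) (at ?a)"
    using assms by (simp add: DERIV_deriv_iff_field_differentiable)
  then obtain g where g: "\<And>w. f w - f ?a = g w * (w - ?a)"
      and cont: "isCont g ?a" and ga: "g ?a = deriv f ?a"
    by (auto simp: CARAT_DERIV)
  let ?u = "\<lambda>y. (csqrt y + \<i> / 2)\<^sup>2" and ?v = "\<lambda>y. (csqrt y - \<i> / 2)\<^sup>2"
  have "((\<lambda>y. norm (csqrt y)) \<longlongrightarrow> sqrt (norm (0::complex))) (at 0)"
    unfolding norm_csqrt by (intro tendsto_intros)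
  then have s: "(csqrt \<longlongrightarrow> 0) (at 0)"
    unfolding norm_zero real_sqrt_zero by (rule tendsto_norm_zero_cancel)
  have a: "(0 + \<i> / 2)\<^sup>2 = ?a" "(0 - \<i> / 2)\<^sup>2 = ?a"
    by (simp_all add: power2_eq_square)
  have "(?u \<longlongrightarrow> (0 + \<i> / 2)\<^sup>2) (at 0)" "(?v \<longlongrightarrow> (0 - \<i> / 2)\<^sup>2) (at 0)"
    by (intro tendsto_intros s)+
  then have uv: "(?u \<longlongrightarrow> ?a) (at 0)" "(?v \<longlongrightarrow> ?a) (at 0)"
    unfolding a by simp_all
  have "((\<lambda>y. g (?u y) * ((csqrt y + \<i>) / (2 * \<i>)) - g (?v y) * ((csqrt y - \<i>) / (2 * \<i>)))
      \<longlongrightarrow> g ?a * ((0 + \<i>) / (2 * \<i>)) - g ?a * ((0 - \<i>) / (2 * \<i>))) (at 0)"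
    by (intro tendsto_intros isCont_tendsto_compose[OF cont] uv s) simp_all
  also have "g ?a * ((0 + \<i>) / (2 * \<i>)) - g ?a * ((0 - \<i>) / (2 * \<i>)) = deriv f ?a"
    using ga by (simp add: field_simps)
  finally have lim: "((\<lambda>y. g (?u y) * ((csqrt y + \<i>) / (2 * \<i>)) - g (?v y) * ((csqrt y - \<i>) / (2 * \<i>)))
      \<longlongrightarrow> deriv f ?a) (at 0)" .
  have eq: "wilson_quotient f (csqrt y) =
      g (?u y) * ((csqrt y + \<i>) / (2 * \<i>)) - g (?v y) * ((csqrt y - \<i>) / (2 * \<i>))"
    if "y \<noteq> 0" for y
  proof -
    define z where "z = csqrt y"
    have z: "z \<noteq> 0"
      using that by (simp add: z_def)
    have 1: "(z + \<i> / 2)\<^sup>2 - ?a = z * (z + \<i>)" "(z - \<i> / 2)\<^sup>2 - ?a = z * (z - \<i>)"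
      by (simp_all add: power2_eq_square algebra_simps)
    have "f ((z + \<i> / 2)\<^sup>2) - f ((z - \<i> / 2)\<^sup>2) =
        g ((z + \<i> / 2)\<^sup>2) * (z * (z + \<i>)) - g ((z - \<i> / 2)\<^sup>2) * (z * (z - \<i>))"
      using g[of "(z + \<i> / 2)\<^sup>2"] g[of "(z - \<i> / 2)\<^sup>2"] unfolding 1
      by (metis (no_types, lifting) diff_diff_eq2 diff_add_cancel)
    moreover have "(G * (z * (z + \<i>)) - H * (z * (z - \<i>))) / (2 * \<i> * z) =
        G * ((z + \<i>) / (2 * \<i>)) - H * ((z - \<i>) / (2 * \<i>))" for G H
      using z by (simp add: divide_simps) (simp add: algebra_simps)
    ultimately show ?thesis
      unfolding wilson_quotient_def z_def[symmetric] by simp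
  qed
  have "((\<lambda>y. wilson_quotient f (csqrt y)) \<longlongrightarrow> deriv f ?a) (at 0)"
    by (rule Lim_transform_eventually[OF lim])
       (use eq in \<open>auto simp: eventually_at_filter\<close>)
  then show ?thesis
    by (simp add: wilson_def tendsto_Lim)
qed


section \<open>Nevanlinna theory\<close>

text \<open>The maximum makes this \<open>0\<close> for all \<open>x \<le> 1\<close>; the library's \<open>ln\<close> is \<open>ln \<bar>x\<bar>\<close> for \<open>x < 0\<close>.\<close>

definition ln_plus :: "real \<Rightarrow> real" where
  "ln_plus x = ln (max 1 x)"

text \<open>
  \<open>n(r,f)\<close>; the sum is finite for a function meromorphic on the whole plane.
\<close>

definition pole_count :: "real \<Rightarrow> (complex \<Rightarrow> complex) \<Rightarrow> nat" where
  "pole_count r f = (\<Sum>z | norm z \<le> r \<and> is_pole f z. nat (- zorder f z))"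

text \<open>
  \<open>n(r,f) + n(r,1/f)\<close>. Functions normalised by \<open>nicely_meromorphic_on\<close> have the value \<open>0\<close> at
  their poles, so with \<open>1 / 0 = 0\<close> the function \<open>\<lambda>z. 1 / f z\<close> is correct there as well.
\<close>

definition zero_pole_count :: "real \<Rightarrow> (complex \<Rightarrow> complex) \<Rightarrow> nat" where
  "zero_pole_count r f = pole_count r f + pole_count r (\<lambda>z. 1 / f z)"

definition proximity :: "real \<Rightarrow> (complex \<Rightarrow> complex) \<Rightarrow> real" where
  "proximity r f = 1 / (2 * pi) * integral {-pi..pi} (\<lambda>\<theta>. ln_plus (norm (f (rcis r \<theta>))))"

definition integrated_count :: "real \<Rightarrow> (complex \<Rightarrow> complex) \<Rightarrow> real" where
  "integrated_count r f =
     integral {0..r} (\<lambda>t. (real (pole_count t f) - real (pole_count 0 f)) / t)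
       + real (pole_count 0 f) * ln r"

definition nevanlinna_T :: "real \<Rightarrow> (complex \<Rightarrow> complex) \<Rightarrow> real" where
  "nevanlinna_T r f = proximity r f + integrated_count r f"

definition growth_order :: "(complex \<Rightarrow> complex) \<Rightarrow> ereal" where
  "growth_order f = Limsup at_top (\<lambda>r::real. ereal (ln_plus (nevanlinna_T r f) / ln r))"

end

theory Submission
  imports Defs "HOL-Real_Asymp.Real_Asymp"
begin

text \<open>
  For \<open>x = z\<^sup>2\<close> and a bounded real \<open>s\<close>, the point \<open>w = (z + is)\<^sup>2\<close> has distance \<open>O(\<surd>r)\<close> from \<open>x\<close>, where \<open>r = \<bar>x\<bar>\<close>.
  Subtracting the Poisson--Jensen formulas on the circle of radius \<open>\<gamma>r\<close> at the two points bounds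
  \<open>ln \<bar>f(w) / f(x)\<bar>\<close> by a multiple of \<open>T(\<gamma>r,f) / \<surd>r\<close> plus \<open>\<surd>r\<close> times the sums of \<open>1 / \<bar>x - a\<bar>\<close> and \<open>1 / \<bar>w - a\<bar>\<close> over
  the zeros and poles \<open>a\<close> of modulus at most \<open>\<gamma>r\<close>.

  Since \<open>w - a = (z + is - b)(z + is + b)\<close> with \<open>b\<^sup>2 = a\<close>, and the distance from a point of a ray to a fixed point is at
  least its modulus times the sine of an angle, these sums are \<open>O(1/r)\<close> times sums of \<open>1 / \<bar>\<theta> - c\<bar>\<close> over real
  numbers \<open>c\<close> that depend only on \<open>a\<close> and \<open>s\<close>. For \<open>n\<close> numbers \<open>c\<close>, such a sum is at most \<open>O((n/H) ln(1 + n/H))\<close> off a set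
  of measure \<open>O(H)\<close>. Applying this with \<open>H = k powr (-q)\<close> and \<open>1 < q < \<gamma>\<close> to the annulus with radii about \<open>\<gamma> powr (k/2)\<close>,
  the Borel--Cantelli lemma gives the bound for almost every \<open>\<theta>\<close>.

  The factor \<open>1 / (2iz)\<close> in the Wilson operator absorbs all bounded terms. The \<open>k\<close>-th iterate at \<open>z\<^sup>2\<close> is controlled directly by
  the values of \<open>f\<close> at the points \<open>(z + ij/2)\<^sup>2\<close> with \<open>\<bar>j\<bar> \<le> k\<close>, and Jensen's formula bounds the counting function in terms of
  \<open>T\<close>; so nothing has to be known about the order of the iterates.
\<close>


section \<open>The Poisson formula\<close>

text \<open>Cauchy's formula on the parameter interval [-pi, pi] instead of [0, 2 pi]: it is applied
  to G(-u) at the point -w, and the shift of the parameter by pi, which negates \<open>cis\<close>,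
  undoes the reflection.\<close>

lemma has_integral_circle_Cauchy:
  fixes G :: "complex \<Rightarrow> complex"
  assumes "G holomorphic_on cball 0 R" "norm w < R"
  shows "((\<lambda>t. G (rcis R t) * rcis R t / (rcis R t - w)) has_integral (2 * pi * G w)) {-pi..pi}"
proof -
  have hol: "(\<lambda>u. G (- u)) holomorphic_on cball 0 R"
    by (rule holomorphic_on_compose_gen[of "\<lambda>u. - u" _ G "cball 0 R", unfolded o_def])
      (use assms(1) in \<open>auto intro!: holomorphic_intros\<close>)
  have "((\<lambda>u. G (- u) / (u - (- w))) has_contour_integral (2 * of_real pi * \<i> * G (- (- w)))) (circlepath 0 R)"
    by (rule Cauchy_integral_circlepath_simple[OF hol]) (use assms(2) in auto)
  then have "((\<lambda>t. G (- (0 + R * cis t)) / (0 + R * cis t - - w) * R * \<i> * cis t) has_integral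
      (2 * of_real pi * \<i> * G w)) {0..2*pi}"
    unfolding circlepath_def by (subst (asm) has_contour_integral_part_circlepath_iff) auto
  then have "((\<lambda>t. G (- (R * cis t)) / (R * cis t + w) * R * \<i> * cis t) has_integral
      (2 * of_real pi * \<i> * G w)) (cbox 0 (2*pi))"
    by simp
  from has_integral_affinity[OF this, of 1 pi]
  have 1: "((\<lambda>t. G (- (R * cis (t + pi))) / (R * cis (t + pi) + w) * R * \<i> * cis (t + pi)) has_integral
      (2 * of_real pi * \<i> * G w)) {-pi..pi}"
    by (simp add: image_affinity_atLeastAtMost)
  have cis: "cis (t + pi) = - cis t" for t
    by (simp add: complex_eq_iff)
  have "norm (R * cis t) \<noteq> norm w" for t
    using assms(2) norm_ge_zero[of w] by (simp add: norm_mult)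
  then have ne: "R * cis t - w \<noteq> 0" for t
    by (metis right_minus_eq)
  have 2: "G (- (R * cis (t + pi))) / (R * cis (t + pi) + w) * R * \<i> * cis (t + pi) / \<i>
      = G (rcis R t) * rcis R t / (rcis R t - w)" for t
  proof -
    have "R * cis (t + pi) + w = - (R * cis t - w)"
      unfolding cis by simp
    then show ?thesis
      unfolding cis rcis_def using ne[of t] by (simp add: field_simps)
  qed
  have 3: "2 * of_real pi * \<i> * G w / \<i> = 2 * pi * G w"
    by (simp only: times_divide_eq_right[symmetric] mult.commute[of _ \<i>] mult.assoc) simp
  from has_integral_divide[OF 1, of \<i>] show ?thesis
    unfolding 2 3 .
qed

text \<open>The Poisson kernel as the real part of the Schwarz kernel; with z = R e^(it) it equals
  (R^2 - |w|^2) / |z - w|^2. The factor 1 / (2 pi) is left to the integrals.\<close>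

definition poisson :: "real \<Rightarrow> complex \<Rightarrow> real \<Rightarrow> real" where
  "poisson R w t = Re ((rcis R t + w) / (rcis R t - w))"

lemma norm_rcis_minus_ge: "R - norm w \<le> norm (rcis R t - w)" 
  using norm_triangle_ineq2[of "rcis R t" w] by simp

lemma rcis_minus_nonzero: "norm w < R \<Longrightarrow> rcis R t - w \<noteq> 0"
  using norm_rcis_minus_ge[of R w t] by auto

lemma poisson_nonneg:
  assumes "norm w < R"
  shows "poisson R w t \<ge> 0"
proof -
  have "Re ((z + w) / (z - w)) = ((norm z)\<^sup>2 - (norm w)\<^sup>2) / (norm (z - w))\<^sup>2" for z
    unfolding cmod_power2 by (simp add: Re_divide) (simp add: power2_eq_square algebra_simps)
  moreover have "(norm w)\<^sup>2 \<le> R\<^sup>2"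
    using assms by (intro power_mono) auto
  ultimately show ?thesis
    unfolding poisson_def by simp
qed

lemma poisson_zero: "R > 0 \<Longrightarrow> poisson R 0 t = 1"
  using rcis_minus_nonzero[of 0 R t] by (simp add: poisson_def)

text \<open>The difference of the two Schwarz kernels is 2 z (w - v) / ((z - w) (z - v)), and both
  factors of the denominator have modulus at least R - \<rho>. The factor |w - v| is what later puts
  sqrt r below the characteristic.\<close>

lemma poisson_diff_le:
  assumes "norm v \<le> \<rho>" "norm w \<le> \<rho>" "\<rho> < R"
  shows "\<bar>poisson R w t - poisson R v t\<bar> \<le> 2 * R * norm (w - v) / (R - \<rho>)\<^sup>2"
proof -
  let ?z = "rcis R t"
  have "R > 0"
    using assms norm_ge_zero by (meson le_less_trans)
  have nz: "?z - w \<noteq> 0" "?z - v \<noteq> 0"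
    using assms by (auto intro!: rcis_minus_nonzero)
  have "\<bar>poisson R w t - poisson R v t\<bar> \<le> norm ((?z + w) / (?z - w) - (?z + v) / (?z - v))"
    unfolding poisson_def minus_complex.sel(1)[symmetric] by (rule abs_Re_le_cmod)
  also have "(?z + w) / (?z - w) - (?z + v) / (?z - v) = 2 * ?z * (w - v) / ((?z - w) * (?z - v))"
    using nz by (simp add: divide_simps) (simp add: algebra_simps)
  also have "norm \<dots> = 2 * R * norm (w - v) / (norm (?z - w) * norm (?z - v))"
    using \<open>R > 0\<close> by (simp add: norm_mult norm_divide)
  also have "\<dots> \<le> 2 * R * norm (w - v) / (R - \<rho>)\<^sup>2"
    unfolding power2_eq_square
    using norm_rcis_minus_ge[of R w t] norm_rcis_minus_ge[of R v t] assms \<open>R > 0\<close>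
    by (intro divide_left_mono mult_mono mult_nonneg_nonneg mult_pos_pos) auto
  finally show ?thesis .
qed

text \<open>On the circle the kernel is z / (z - w) plus the conjugate of w / (z - w), and cnj z =
  R^2 / z turns the second summand into the boundary values of a holomorphic function that vanishes
  at 0. So the first summand gives Cauchy's formula at w, and the second one integrates to
  0.\<close>

lemma Poisson_formula:
  fixes h :: "complex \<Rightarrow> complex"
  assumes h: "h holomorphic_on cball 0 R" and w: "norm w < R"
  shows "((\<lambda>t. h (rcis R t) * of_real (poisson R w t)) has_integral (2 * pi * h w)) {-pi..pi}"
proof -
  have "R > 0"
    using w norm_ge_zero le_less_trans by blast
  define G where "G = (\<lambda>z. h z * (cnj w * z / (of_real (R\<^sup>2) - cnj w * z)))"
  have nz: "of_real (R\<^sup>2) - cnj w * z \<noteq> 0" if "z \<in> cball 0 R" for z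
  proof
    assume "of_real (R\<^sup>2) - cnj w * z = 0"
    then have "cnj w * z = of_real (R\<^sup>2)"
      by simp
    then have "norm (cnj w * z) = R\<^sup>2"
      by (metis norm_of_real abs_power2)
    moreover have "norm (cnj w * z) \<le> norm w * R"
      using that by (simp add: norm_mult mult_left_mono)
    moreover have "norm w * R < R\<^sup>2"
      using w \<open>R > 0\<close> by (simp add: power2_eq_square)
    ultimately show False
      by simp
  qed
  have "G holomorphic_on cball 0 R"
    unfolding G_def using nz by (intro holomorphic_intros h) auto
  from has_integral_circle_Cauchy[OF this, of 0]
  have 1: "((\<lambda>t. G (rcis R t)) has_integral 0) {-pi..pi}"
    using \<open>R > 0\<close> by (simp add: G_def)
  have "((\<lambda>t. h (rcis R t) * rcis R t / (rcis R t - w) + G (rcis R t)) has_integral (2 * pi * h w + 0)) {-pi..pi}"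
    by (intro has_integral_add 1 has_integral_circle_Cauchy assms)
  moreover have "h (rcis R t) * rcis R t / (rcis R t - w) + G (rcis R t)
      = h (rcis R t) * of_real (poisson R w t)" for t
  proof -
    define z where "z = rcis R t"
    have z: "z - w \<noteq> 0"
      unfolding z_def using w by (rule rcis_minus_nonzero)
    then have z': "cnj z - cnj w \<noteq> 0"
      by (metis complex_cnj_diff complex_cnj_zero_iff)
    have n: "norm z = R"
      using \<open>R > 0\<close> by (simp add: z_def)
    have zz: "z * cnj z = of_real (R\<^sup>2)"
      using complex_norm_square[of z] n by simp
    have "z \<noteq> 0"
      using n \<open>R > 0\<close> by auto
    have "of_real (poisson R w t) = ((z + w) / (z - w) + cnj ((z + w) / (z - w))) / 2"
      unfolding poisson_def z_def[symmetric] complex_add_cnj by simp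
    also have "\<dots> = z / (z - w) + cnj w / (cnj z - cnj w)"
      using z z' by (simp add: divide_simps) (simp add: algebra_simps)
    also have "cnj w / (cnj z - cnj w) = cnj w * z / (of_real (R\<^sup>2) - cnj w * z)"
    proof -
      have "of_real (R\<^sup>2) - cnj w * z = z * (cnj z - cnj w)"
        unfolding zz[symmetric] by (simp add: algebra_simps)
      then show ?thesis
        using \<open>z \<noteq> 0\<close> by simp
    qed
    finally show ?thesis
      unfolding G_def z_def[symmetric] by (simp add: algebra_simps)
  qed
  ultimately show ?thesis
    by simp
qed

text \<open>The real part of the Poisson formula for a holomorphic logarithm of g. To have this
  logarithm on the closed disc, g is first seen, by compactness, to be holomorphic without zeros on
  a slightly larger open disc.\<close>

lemma Poisson_ln_norm:
  assumes g: "g analytic_on cball 0 R" "\<And>z. norm z \<le> R \<Longrightarrow> g z \<noteq> 0" and w: "norm w < R"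
  shows "((\<lambda>t. ln (norm (g (rcis R t))) * poisson R w t) has_integral (2 * pi * ln (norm (g w)))) {-pi..pi}"
proof -
  have "R > 0"
    using w norm_ge_zero le_less_trans by blast
  obtain S where S: "open S" "cball 0 R \<subseteq> S" "g holomorphic_on S"
    using g(1) by (auto simp: analytic_on_holomorphic)
  define T where "T = S \<inter> g -` (- {0})"
  have "open T"
    unfolding T_def using S
    by (intro continuous_open_preimage holomorphic_on_imp_continuous_on) auto
  moreover have "cball 0 R \<subseteq> T"
    using S g(2) by (auto simp: T_def)
  ultimately obtain \<epsilon> where eps: "\<epsilon> > 0" "(\<Union>x\<in>cball 0 R. ball x \<epsilon>) \<subseteq> T"
    using compact_subset_open_imp_ball_epsilon_subset[of "cball 0 R :: complex set" T] by auto
  have sub: "ball 0 (R + \<epsilon>) \<subseteq> T"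
  proof
    fix z :: complex assume z: "z \<in> ball 0 (R + \<epsilon>)"
    show "z \<in> T"
    proof (cases "norm z \<le> R")
      case True
      then show ?thesis using \<open>cball 0 R \<subseteq> T\<close> by auto
    next
      case False
      \<comment> \<open>The radial projection of z to the circle, at distance |z| - R < \<epsilon>
        from z.\<close>
      define u where "u = of_real (R / norm z) * z"
      have "norm u = R"
        using False \<open>R > 0\<close> by (auto simp: u_def norm_mult norm_divide)
      then have nu: "u \<in> cball 0 R"
        by simp
      have "z - u = of_real (1 - R / norm z) * z"
        by (simp add: u_def algebra_simps)
      then have "norm (z - u) = \<bar>1 - R / norm z\<bar> * norm z"
        by (simp only: norm_mult norm_of_real)
      moreover have "\<bar>1 - R / norm z\<bar> = 1 - R / norm z" "z \<noteq> 0"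
        using False \<open>R > 0\<close> divide_le_eq_1[of R "norm z"] by auto
      ultimately have "norm (z - u) = norm z - R"
        using False \<open>R > 0\<close> by (simp add: left_diff_distrib)
      then have "z \<in> ball u \<epsilon>"
        using z by (simp add: dist_norm norm_minus_commute)
      with nu show ?thesis
        using eps(2) by blast
    qed
  qed
  have "0 \<in> ball 0 (R + \<epsilon>)"
    using \<open>R > 0\<close> eps(1) by auto
  then obtain h where h: "h holomorphic_on ball 0 (R + \<epsilon>)" "\<And>z. z \<in> ball 0 (R + \<epsilon>) \<Longrightarrow> exp (h z) = g z"
    using holomorphic_logarithm_exists[of "ball 0 (R + \<epsilon>)" g 0] sub
      holomorphic_on_subset[OF S(3)] unfolding T_def
    by (metis (no_types, lifting) ComplD IntD2 convex_ball le_inf_iff open_ball singletonI subset_iff vimageD)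
  have ln: "ln (norm (g z)) = Re (h z)" if "norm z \<le> R" for z
    using h(2)[of z] that eps(1) by (metis add.right_neutral add_le_less_mono mem_ball_0 ln_exp norm_exp_eq_Re)
  have "((\<lambda>t. h (rcis R t) * of_real (poisson R w t)) has_integral (2 * pi * h w)) {-pi..pi}"
    by (intro Poisson_formula holomorphic_on_subset[OF h(1)] w) (use eps(1) in auto)
  from has_integral_linear[OF this bounded_linear_Re]
  have "((\<lambda>t. Re (h (rcis R t)) * poisson R w t) has_integral (2 * pi * Re (h w))) {-pi..pi}"
    by (simp add: o_def)
  then show ?thesis
    using ln w \<open>R > 0\<close> by simp
qed

lemma finite_rcis_eq: "R > 0 \<Longrightarrow> finite {t \<in> {-pi..pi}. rcis R t = a}"
proof (rule finite_subset)
  assume "R > 0"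
  \<comment> \<open>The endpoint -pi is listed separately because \<open>Arg\<close> takes values in
    (-pi, pi].\<close>
  show "{t \<in> {-pi..pi}. rcis R t = a} \<subseteq> {-pi, Arg (a / R)}"
  proof safe
    fix t assume "t \<in> {-pi..pi}" "t \<noteq> - pi" 
    then have "t \<in> {-pi<..pi}"
      by auto
    then show "t = Arg (rcis R t / complex_of_real R)"
      using \<open>R > 0\<close> Arg_cis[of t] by (simp add: rcis_def)
  qed
qed auto

text \<open>The logarithmic singularity lies on the circle itself. It is approached from outside by
  the points \<open>s n * a\<close>, where the formula for functions without zeros applies; on the
  circle the logarithms decrease with n, so monotone convergence gives the limit.\<close>

lemma Poisson_ln_norm_diff_circle:
  assumes a: "norm a = R" and w: "norm w < R"
  shows "((\<lambda>t. ln (norm (rcis R t - a)) * poisson R w t) has_integral (2 * pi * ln (norm (w - a)))) {-pi..pi}"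
proof -
  have "R > 0"
    using w norm_ge_zero le_less_trans by blast
  define s where "s = (\<lambda>n. 1 + inverse (real (Suc n)))"
  define N where "N = {t \<in> {-pi..pi}. rcis R t = a}"
  \<comment> \<open>On the finite set \<open>N\<close> the integrands are set to 0: there the
    logarithms tend to minus infinity, whereas \<open>ln 0 = 0\<close>, so pointwise convergence
    would fail.\<close>
  let ?u = "\<lambda>n t. if t \<in> N then 0 else ln (norm (rcis R t - of_real (s n) * a)) * poisson R w t"
  let ?u' = "\<lambda>t. if t \<in> N then 0 else ln (norm (rcis R t - a)) * poisson R w t"
  have fin: "finite N"
    unfolding N_def by (rule finite_rcis_eq) fact
  have s1: "s n > 1" for n
    by (simp add: s_def)
  have s_dec: "s (Suc n) \<le> s n" for n
    by (simp add: s_def)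
  have s_lim: "s \<longlonglongrightarrow> 1"
    unfolding s_def using LIMSEQ_inverse_real_of_nat_add[of 1] by simp
  have int: "(?u n has_integral (2 * pi * ln (norm (w - of_real (s n) * a)))) {-pi..pi}" for n
  proof (rule has_integral_spike_finite[OF fin])
    show "((\<lambda>t. ln (norm (rcis R t - of_real (s n) * a)) * poisson R w t) has_integral
        (2 * pi * ln (norm (w - of_real (s n) * a)))) {-pi..pi}"
    proof (rule Poisson_ln_norm[of "\<lambda>z. z - of_real (s n) * a", OF _ _ w])
      show "z - of_real (s n) * a \<noteq> 0" if "norm z \<le> R" for z
      proof
        assume "z - of_real (s n) * a = 0"
        then have "z = of_real (s n) * a"
          by simp
        then have "norm z = s n * R"
          using a s1[of n] by (simp add: norm_mult)
        then show False
          using that s1[of n] \<open>R > 0\<close> by simp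
      qed
    qed (intro analytic_intros)
  qed auto
  have lim: "(\<lambda>n. 2 * pi * ln (norm (w - of_real (s n) * a))) \<longlonglongrightarrow> 2 * pi * ln (norm (w - of_real 1 * a))"
    using a w by (intro tendsto_intros s_lim) auto
  \<comment> \<open>For |z| = |a| = R the square of |z - x a| is a quadratic polynomial in x that
    increases for x >= 1, since the inner product of z and a is at most R^2.\<close>
  have mono: "ln (norm (z - of_real (s (Suc n)) * a)) \<le> ln (norm (z - of_real (s n) * a))"
    if z: "norm z = R" "z \<noteq> a" for z n
  proof -
    have sq: "(norm (z - of_real x * a))\<^sup>2 = R\<^sup>2 + x\<^sup>2 * R\<^sup>2 - 2 * x * (z \<bullet> a)" for x :: real
    proof -
      have "(norm (z - x *\<^sub>R a))\<^sup>2 = (norm z)\<^sup>2 + (norm (x *\<^sub>R a))\<^sup>2 - 2 * (z \<bullet> (x *\<^sub>R a))"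
        unfolding power2_norm_eq_inner inner_diff_left inner_diff_right by (simp add: inner_commute)
      then show ?thesis
        unfolding inner_scaleR_right norm_scaleR using z(1) a
        by (simp add: scaleR_conv_of_real power_mult_distrib)
    qed
    have le: "z \<bullet> a \<le> R\<^sup>2"
      using norm_cauchy_schwarz[of z a] z a by (simp add: power2_eq_square)
    have "(norm (z - of_real (s n) * a))\<^sup>2 - (norm (z - of_real (s (Suc n)) * a))\<^sup>2
        = (s n - s (Suc n)) * ((s n + s (Suc n)) * R\<^sup>2 - 2 * (z \<bullet> a))"
      unfolding sq by (simp add: power2_eq_square algebra_simps)
    also have "\<dots> \<ge> 0"
    proof (intro mult_nonneg_nonneg)
      have "2 * R\<^sup>2 \<le> (s n + s (Suc n)) * R\<^sup>2"
        using s1[of n] s1[of "Suc n"] by (intro mult_right_mono) auto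
      then show "0 \<le> (s n + s (Suc n)) * R\<^sup>2 - 2 * (z \<bullet> a)"
        using le by simp
    qed (use s_dec[of n] in auto)
    finally have "norm (z - of_real (s (Suc n)) * a) \<le> norm (z - of_real (s n) * a)"
      by (auto intro: power2_le_imp_le)
    moreover have "z - of_real (s (Suc n)) * a \<noteq> 0"
    proof
      assume "z - of_real (s (Suc n)) * a = 0"
      then have "z = of_real (s (Suc n)) * a"
        by simp
      then have "norm z = s (Suc n) * R"
        using a s1[of "Suc n"] by (simp add: norm_mult)
      then show False
        using z(1) s1[of "Suc n"] \<open>R > 0\<close> by simp
    qed
    ultimately show ?thesis
      by (simp only: ln_mono zero_less_norm_iff not_False_eq_True)
  qed
  have "?u' integrable_on {-pi..pi} \<and> (\<lambda>n. integral {-pi..pi} (?u n)) \<longlonglongrightarrow> integral {-pi..pi} ?u'"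
  proof (rule monotone_convergence_decreasing)
    show "?u n integrable_on {-pi..pi}" for n
      using int by blast
    show "?u (Suc n) t \<le> ?u n t" if "t \<in> {-pi..pi}" for n t
      using that mono[of "rcis R t" n] poisson_nonneg[OF w, of t] \<open>R > 0\<close>
      by (auto simp: N_def intro!: mult_right_mono)
    show "(\<lambda>n. ?u n t) \<longlonglongrightarrow> ?u' t" if "t \<in> {-pi..pi}" for t
    proof (cases "t \<in> N")
      case False
      then have "rcis R t - of_real 1 * a \<noteq> 0"
        using that by (auto simp: N_def)
      then have "(\<lambda>n. ln (norm (rcis R t - of_real (s n) * a)) * poisson R w t)
          \<longlonglongrightarrow> ln (norm (rcis R t - of_real 1 * a)) * poisson R w t"
        by (intro tendsto_intros s_lim) auto
      then show ?thesis
        using False by simp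
    qed auto
    show "bounded (range (\<lambda>k. integral {-pi..pi} (?u k)))"
      unfolding integral_unique[OF int] using lim by (rule convergent_imp_bounded)
  qed
  then have "(?u' has_integral (integral {-pi..pi} ?u')) {-pi..pi}" 
    and "(\<lambda>n. 2 * pi * ln (norm (w - of_real (s n) * a))) \<longlonglongrightarrow> integral {-pi..pi} ?u'"
    unfolding integral_unique[OF int] by blast+
  moreover from this(2) lim have "integral {-pi..pi} ?u' = 2 * pi * ln (norm (w - of_real 1 * a))"
    by (rule LIMSEQ_unique)
  ultimately have "(?u' has_integral (2 * pi * ln (norm (w - a)))) {-pi..pi}"
    by simp
  then show ?thesis
    by (rule has_integral_spike_finite[OF fin, rotated]) auto
qed

text \<open>For |a| < R the factor z - a has a zero in the disc, but it has the same modulus on the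
  circle as (R^2 - cnj a z) / R, which has none in the closed disc.\<close>

lemma Poisson_ln_norm_diff:
  assumes a: "norm a \<le> R" and w: "norm w < R"
  shows "((\<lambda>t. ln (norm (rcis R t - a)) * poisson R w t) has_integral
           (2 * pi * ln (norm (of_real (R\<^sup>2) - cnj a * w) / R))) {-pi..pi}"
proof (cases "norm a = R")
  case True
  have "R > 0"
    using w norm_ge_zero le_less_trans by blast
  have "of_real (R\<^sup>2) - cnj a * w = cnj a * (a - w)"
    using complex_norm_square[of a] True by (simp add: algebra_simps)
  then have "norm (of_real (R\<^sup>2) - cnj a * w) / R = norm (w - a)"
    using True \<open>R > 0\<close> by (simp add: norm_mult norm_minus_commute)
  then show ?thesis
    using Poisson_ln_norm_diff_circle[OF True w] by simp
next
  case False
  have "R > 0"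
    using w norm_ge_zero le_less_trans by blast
  let ?g = "\<lambda>z. (of_real (R\<^sup>2) - cnj a * z) / of_real R"
  have "?g z \<noteq> 0" if "norm z \<le> R" for z
  proof
    assume "?g z = 0"
    then have "cnj a * z = of_real (R\<^sup>2)"
      using \<open>R > 0\<close> by simp
    then have "norm (cnj a * z) = R\<^sup>2"
      by (metis norm_of_real abs_power2)
    moreover have "norm (cnj a * z) \<le> norm a * R"
      using that by (simp add: norm_mult mult_left_mono)
    moreover have "norm a * R < R\<^sup>2"
      using a False \<open>R > 0\<close> by (simp add: power2_eq_square)
    ultimately show False
      by simp
  qed
  then have "((\<lambda>t. ln (norm (?g (rcis R t))) * poisson R w t) has_integral (2 * pi * ln (norm (?g w)))) {-pi..pi}"
    using \<open>R > 0\<close> by (intro Poisson_ln_norm w) (auto intro!: analytic_intros)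
  moreover have "norm (?g (rcis R t)) = norm (rcis R t - a)" for t
  proof -
    define z where "z = rcis R t"
    have n: "norm z = R"
      using \<open>R > 0\<close> by (simp add: z_def)
    have "of_real (R\<^sup>2) - cnj a * z = z * cnj (z - a)"
      using complex_norm_square[of z] n by (simp add: algebra_simps)
    then show ?thesis
      unfolding z_def[symmetric] using n \<open>R > 0\<close> by (simp add: norm_divide norm_mult del: complex_cnj_diff)
  qed
  ultimately show ?thesis
    using \<open>R > 0\<close> by (simp add: norm_divide)
qed


section \<open>Zeros and poles of a meromorphic function\<close>

lemma ln_power_int: "x > 0 \<Longrightarrow> ln (x powi n) = of_int n * ln x" for x :: real
  using ln_powr[of x "of_int n"] by (simp add: powr_real_of_int')

locale nonzero_meromorphic =
  fixes f :: "complex \<Rightarrow> complex"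
  assumes mero: "f nicely_meromorphic_on UNIV" and nonzero: "f \<noteq> (\<lambda>_. 0)"
begin

lemma nonzero_cosparse: "\<forall>\<^sub>\<approx>x\<in>UNIV. f x \<noteq> 0"
  using nicely_meromorphic_imp_constant_or_avoid[OF mero, of 0] nonzero by auto

lemma eventually_nonzero: "\<forall>\<^sub>F x in at a. f x \<noteq> 0"
  using nonzero_cosparse by (simp add: eventually_cosparse_open_eq)

lemma frequently_nonzero: "\<exists>\<^sub>F x in at a. f x \<noteq> 0"
  using eventually_nonzero by (simp add: eventually_frequently)

lemma mero_at: "f meromorphic_on {a}"
  using mero meromorphic_on_subset unfolding nicely_meromorphic_on_def by blast

lemma isolated_singularity: "isolated_singularity_at f a"
  and not_essential: "not_essential f a"
  using mero_at[of a] by (auto simp: meromorphic_at_iff)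

lemma is_pole_iff: "is_pole f a \<longleftrightarrow> zorder f a < 0"
  using isolated_pole_imp_neg_zorder[OF isolated_singularity]
    neg_zorder_imp_is_pole[OF isolated_singularity not_essential _ frequently_nonzero] by blast

lemma isolated_zero_iff: "isolated_zero f a \<longleftrightarrow> zorder f a > 0"
  using zorder_isolated_zero_pos'[OF _ isolated_singularity]
    zorder_pos_imp_isolated_zero[OF mero_at eventually_nonzero] by blast

text \<open>Nicely meromorphic functions take the value 0 at their poles too, so nonvanishing at a
  point excludes zeros and poles at once.\<close>

lemma eq_0_iff: "f a = 0 \<longleftrightarrow> zorder f a \<noteq> 0"
proof
  assume "f a = 0"
  then have "isolated_zero f a \<or> is_pole f a"
    using zero_or_pole[OF mero _ _ eventually_nonzero] by blast
  then show "zorder f a \<noteq> 0"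
    unfolding is_pole_iff isolated_zero_iff by auto
next
  assume "zorder f a \<noteq> 0"
  then have "isolated_zero f a \<or> is_pole f a"
    unfolding is_pole_iff isolated_zero_iff by auto
  then show "f a = 0"
    using zero_isolated_zero_nicely_meromorphic[of f a] is_pole_zero_at_nicely_mero[OF mero]
      nicely_meromorphic_on_subset[OF mero] by blast
qed

lemma inverse_locale: "nonzero_meromorphic (\<lambda>z. 1 / f z)"
proof
  show "(\<lambda>z. 1 / f z) nicely_meromorphic_on UNIV"
    using nicely_meromorphic_on_inverse[OF mero] by (simp add: inverse_eq_divide)
  obtain z where "f z \<noteq> 0"
    using nonzero by auto
  then have "1 / f z \<noteq> 0"
    by simp
  then show "(\<lambda>z. 1 / f z) \<noteq> (\<lambda>_. 0)"
    by meson
qed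

lemma zorder_inverse: "zorder (\<lambda>z. 1 / f z) a = - zorder f a"
proof -
  have "zorder (\<lambda>z. f z powi (-1)) a = - 1 * zorder f a"
    by (intro zorder_power_int mero_at frequently_nonzero)
  then show ?thesis
    by (simp add: power_int_minus inverse_eq_divide)
qed

text \<open>The support of the divisor in a closed disc; the multiplicities stay in
  \<open>zorder\<close>, positive at zeros and negative at poles.\<close>

definition divisor :: "real \<Rightarrow> complex set" where
  "divisor r = {a. norm a \<le> r \<and> zorder f a \<noteq> 0}"

lemma finite_divisor: "finite (divisor r)"
proof -
  have "{x. f x = 0} sparse_in cball 0 r"
    using nonzero_cosparse by (auto simp: eventually_cosparse intro: sparse_in_subset)
  then have "finite (cball 0 r \<inter> {x. f x = 0})"
    by (rule sparse_in_compact_finite) auto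
  then show ?thesis
    by (rule rev_finite_subset) (auto simp: divisor_def eq_0_iff)
qed

lemma pole_count_eq: "pole_count r f = (\<Sum>a\<in>divisor r. nat (- zorder f a))"
  unfolding pole_count_def is_pole_iff
  by (intro sum.mono_neutral_left finite_divisor) (auto simp: divisor_def)

lemma pole_count_inverse_eq: "pole_count r (\<lambda>z. 1 / f z) = (\<Sum>a\<in>divisor r. nat (zorder f a))"
  unfolding pole_count_def nonzero_meromorphic.is_pole_iff[OF inverse_locale] zorder_inverse
  by (intro sum.mono_neutral_cong_left finite_divisor) (auto simp: divisor_def)

lemma zero_pole_count_eq: "real (zero_pole_count r f) = (\<Sum>a\<in>divisor r. \<bar>real_of_int (zorder f a)\<bar>)"
  unfolding zero_pole_count_def pole_count_eq pole_count_inverse_eq sum.distrib[symmetric] of_nat_sum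
  by (intro sum.cong) auto

text \<open>Multiplying f by the inverse powers of its linear factors gives a function of order 0 at
  every point of the closed disc, which is therefore analytic and nonzero there once its removable
  singularities are removed.\<close>

lemma factorization:
  obtains g where "g analytic_on cball 0 R" "\<And>z. norm z \<le> R \<Longrightarrow> g z \<noteq> 0"
    "\<And>z. norm z \<le> R \<Longrightarrow> z \<notin> divisor R \<Longrightarrow> f z = g z * (\<Prod>a\<in>divisor R. (z - a) powi zorder f a)"
proof -
  define S where "S = divisor R"
  have fin: "finite S"
    by (simp add: S_def finite_divisor)
  define Q where "Q = (\<lambda>z. \<Prod>a\<in>S. (z - a) powi (- zorder f a))"
  \<comment> \<open>\<open>remove_sings\<close> repairs the values at the points of the divisor,
    where the pointwise product is 0 because f is.\<close>
  define g where "g = remove_sings (\<lambda>z. f z * Q z)"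
  have Qmero: "Q meromorphic_on A" for A
    unfolding Q_def by (intro meromorphic_intros)
  have fmero: "f meromorphic_on A" for A
    using mero meromorphic_on_subset unfolding nicely_meromorphic_on_def by blast
  have mero_fQ: "(\<lambda>z. f z * Q z) meromorphic_on A" for A
    by (intro meromorphic_intros fmero Qmero)
  have iso_fQ: "isolated_singularity_at (\<lambda>z. f z * Q z) a" for a
    using mero_fQ[of "{a}"] by (auto simp: meromorphic_at_iff)
  have Qev: "\<forall>\<^sub>F z in at a. Q z \<noteq> 0" for a
  proof -
    have "\<forall>\<^sub>F z in at a. z \<notin> S - {a}"
      by (rule eventually_mono[OF eventually_at_in_open[of "- (S - {a})" a]])
         (use fin in \<open>auto simp del: Compl_Diff_eq intro!: open_Compl finite_imp_closed\<close>)
    moreover have "\<forall>\<^sub>F z in at a. z \<noteq> a"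
      by (rule eventually_neq_at_within)
    ultimately show ?thesis
      by eventually_elim (use fin in \<open>auto simp: Q_def power_int_eq_0_iff\<close>)
  qed
  interpret g: nonzero_meromorphic g
  proof
    show "g nicely_meromorphic_on UNIV"
      unfolding g_def by (intro remove_sings_nicely_meromorphic mero_fQ)
    have "\<forall>\<^sub>F z in at 0. g z = f z * Q z"
      unfolding g_def by (rule eventually_remove_sings_eq_at[OF iso_fQ])
    with Qev[of 0] eventually_nonzero[of 0] have "\<forall>\<^sub>F z in at 0. g z \<noteq> 0"
      by eventually_elim auto
    then have "\<exists>z. g z \<noteq> 0"
      using eventually_happens trivial_limit_at by blast
    then show "g \<noteq> (\<lambda>_. 0)"
      by auto
  qed
  have zlin: "zorder (\<lambda>z. z - b) a = (if a = b then 1 else 0)" for a b :: complex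
  proof (cases "a = b")
    case True
    then show ?thesis
      using zorder_eqI[of UNIV b "\<lambda>_. 1" "\<lambda>z. z - b" 1] by simp
  next
    case False
    then show ?thesis
      using zorder_eqI[of UNIV a "\<lambda>z. z - b" "\<lambda>z. z - b" 0] by (simp add: holomorphic_intros)
  qed
  have zQ: "zorder Q a = (\<Sum>b\<in>S. - zorder f b * (if a = b then 1 else 0))" for a
  proof -
    have "zorder Q a = (\<Sum>b\<in>S. zorder (\<lambda>z. (z - b) powi (- zorder f b)) a)"
      unfolding Q_def
      by (rule zorder_prod) (use Qev in \<open>auto simp: Q_def intro!: meromorphic_intros\<close>)
    also have "\<dots> = (\<Sum>b\<in>S. - zorder f b * (if a = b then 1 else 0))"
    proof (rule sum.cong)
      fix b
      have "zorder (\<lambda>z. (z - b) powi (- zorder f b)) a = - zorder f b * zorder (\<lambda>z. z - b) a"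
      proof (rule zorder_power_int)
        have "\<forall>\<^sub>F z in at a. z \<noteq> b"
          by (cases "a = b") (auto intro: eventually_neq_at_within t1_space_nhds eventually_at_filter
              simp: eventually_neq_at_within)
        then show "\<exists>\<^sub>F z in at a. z - b \<noteq> 0"
          by (intro eventually_frequently) auto
      qed (intro meromorphic_intros)
      then show "zorder (\<lambda>z. (z - b) powi (- zorder f b)) a = - zorder f b * (if a = b then 1 else 0)"
        by (simp only: zlin)
    qed auto
    finally show ?thesis .
  qed
  have zg: "zorder g a = 0" if "norm a \<le> R" for a
  proof -
    have "zorder g a = zorder f a + zorder Q a"
      unfolding g_def using zorder_mult[OF mero_at frequently_nonzero Qmero] Qev[of a] iso_fQ[of a]
      by (simp add: eventually_frequently)
    also have "zorder Q a = - zorder f a"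
      using fin that unfolding zQ by (auto simp: S_def divisor_def sum.delta' if_distrib cong: if_cong)
    finally show ?thesis
      by simp
  qed
  have gana: "g analytic_on {a}" if "norm a \<le> R" for a
    using nicely_meromorphic_on_imp_analytic_at[OF g.mero] g.is_pole_iff[of a] zg[OF that] by auto
  have eq: "f z = g z * (\<Prod>a\<in>S. (z - a) powi zorder f a)" if z: "norm z \<le> R" "z \<notin> S" for z
  proof -
    have "zorder f z = 0"
      using z by (auto simp: S_def divisor_def)
    then have "f analytic_on {z}"
      using nicely_meromorphic_on_imp_analytic_at[OF mero] is_pole_iff[of z] by auto
    then have "(\<lambda>z. f z * Q z) analytic_on {z}"
      unfolding Q_def using z(2) by (intro analytic_intros) auto
    then have "g z = f z * Q z"
      unfolding g_def by (rule remove_sings_at_analytic)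
    moreover have "Q z * (\<Prod>a\<in>S. (z - a) powi zorder f a) = 1"
      unfolding Q_def prod.distrib[symmetric] using z(2)
      by (intro prod.neutral ballI) (unfold power_int_minus, rule left_inverse, auto)
    ultimately show ?thesis
      by (metis mult.assoc mult.right_neutral)
  qed
  show thesis
  proof (rule that)
    show "g analytic_on cball 0 R"
      using gana by (subst analytic_on_analytic_at) auto
    show "g z \<noteq> 0" if "norm z \<le> R" for z
      using zg[OF that] g.eq_0_iff[of z] by auto
    show "f z = g z * (\<Prod>a\<in>divisor R. (z - a) powi zorder f a)"
      if "norm z \<le> R" "z \<notin> divisor R" for z
      using eq that by (simp add: S_def)
  qed
qed

text \<open>The last clause expresses the modulus of the leading Laurent coefficient of f at 0
  through the factorization. The function whose limit is taken does not involve R, which is why the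
  constant in Jensen's formula will not depend on R.\<close>

lemma ln_norm_factorization:
  obtains g where "g analytic_on cball 0 R" "\<And>z. norm z \<le> R \<Longrightarrow> g z \<noteq> 0"
    "\<And>z. norm z \<le> R \<Longrightarrow> z \<notin> divisor R \<Longrightarrow>
       ln (norm (f z)) = ln (norm (g z)) + (\<Sum>a\<in>divisor R. zorder f a * ln (norm (z - a)))"
    "R > 0 \<Longrightarrow> ((\<lambda>z. norm (f z) / norm z powi zorder f 0) \<longlongrightarrow>
       norm (g 0) * (\<Prod>a\<in>divisor R - {0}. norm a powi zorder f a)) (at 0)"
proof -
  obtain g where g: "g analytic_on cball 0 R" "\<And>z. norm z \<le> R \<Longrightarrow> g z \<noteq> 0"
    "\<And>z. norm z \<le> R \<Longrightarrow> z \<notin> divisor R \<Longrightarrow> f z = g z * (\<Prod>a\<in>divisor R. (z - a) powi zorder f a)"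
    by (rule factorization[where R = R]) blast
  have lnf: "ln (norm (f z)) = ln (norm (g z)) + (\<Sum>a\<in>divisor R. zorder f a * ln (norm (z - a)))"
    if z: "norm z \<le> R" "z \<notin> divisor R" for z
  proof -
    have "norm (f z) = norm (g z) * (\<Prod>a\<in>divisor R. norm (z - a) powi zorder f a)"
      using g(3)[OF z] by (simp add: norm_mult norm_power_int flip: prod_norm)
    moreover have "ln (\<Prod>a\<in>divisor R. norm (z - a) powi zorder f a)
        = (\<Sum>a\<in>divisor R. ln (norm (z - a) powi zorder f a))"
      using z by (intro ln_prod finite_divisor) (auto intro!: zero_less_power_int)
    moreover have "\<dots> = (\<Sum>a\<in>divisor R. zorder f a * ln (norm (z - a)))"
      using z by (intro sum.cong ln_power_int) auto
    moreover have "(\<Prod>a\<in>divisor R. norm (z - a) powi zorder f a) > 0"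
      using z by (intro prod_pos) (auto intro!: zero_less_power_int)
    ultimately show ?thesis
      using g(2)[OF z(1)] by (simp add: ln_mult)
  qed
  have lim: "((\<lambda>z. norm (f z) / norm z powi zorder f 0) \<longlongrightarrow>
       norm (g 0) * (\<Prod>a\<in>divisor R - {0}. norm a powi zorder f a)) (at 0)" if "R > 0"
  proof -
    have "g \<midarrow>0\<rightarrow> g 0"
      using g(1) that by (intro isContD analytic_at_imp_isCont) (auto intro: analytic_on_subset)
    then have "((\<lambda>z. norm (g z) * (\<Prod>a\<in>divisor R - {0}. norm (z - a) powi zorder f a)) \<longlongrightarrow>
        norm (g 0) * (\<Prod>a\<in>divisor R - {0}. norm (0 - a) powi zorder f a)) (at 0)"
      by (intro tendsto_intros) auto
    moreover have "\<forall>\<^sub>F z in at 0. norm (g z) * (\<Prod>a\<in>divisor R - {0}. norm (z - a) powi zorder f a)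
        = norm (f z) / norm z powi zorder f 0"
    proof -
      have "\<forall>\<^sub>F z in at 0. z \<notin> divisor R - {0}"
        by (rule eventually_mono[OF eventually_at_in_open[of "- (divisor R - {0})" 0]])
           (use finite_divisor in \<open>auto simp del: Compl_Diff_eq intro!: open_Compl finite_imp_closed\<close>)
      moreover have "\<forall>\<^sub>F z :: complex in at 0. z \<noteq> 0"
        by (rule eventually_neq_at_within)
      moreover have "\<forall>\<^sub>F z :: complex in at 0. z \<in> ball 0 R - {0}"
        using that by (intro eventually_at_in_open) auto
      ultimately show ?thesis
      proof eventually_elim
        case (elim z)
        have "norm (f z) = norm (g z) * (\<Prod>a\<in>divisor R. norm (z - a) powi zorder f a)"
          using g(3)[of z] elim by (simp add: norm_mult norm_power_int flip: prod_norm)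
        moreover have "(\<Prod>a\<in>divisor R. norm (z - a) powi zorder f a)
            = norm z powi zorder f 0 * (\<Prod>a\<in>divisor R - {0}. norm (z - a) powi zorder f a)"
        proof (cases "0 \<in> divisor R")
          case True
          then show ?thesis
            by (subst prod.remove[OF finite_divisor True]) simp
        next
          case False
          then have "zorder f 0 = 0"
            using that by (auto simp: divisor_def)
          then show ?thesis
            using False by simp
        qed
        ultimately show ?case
          using elim by simp
      qed
    qed
    ultimately show ?thesis
      by (auto intro: Lim_transform_eventually)
  qed
  show thesis
    using that g(1,2) lnf lim by blast
qed

end

section \<open>Integrability on circles and the Poisson-Jensen formula\<close>

text \<open>Integrability is the Poisson formula at the centre, where the kernel is 1. As the
  logarithm is bounded above on the circle, integrability already implies absolute
  integrability.\<close>

lemma absolutely_integrable_ln_norm_rcis_diff: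
  assumes "norm a \<le> R" "R > 0"
  shows "(\<lambda>t. ln (norm (rcis R t - a))) absolutely_integrable_on {-pi..pi}"
proof -
  have "(\<lambda>t. ln (norm (rcis R t - a))) integrable_on {-pi..pi}"
    using Poisson_ln_norm_diff[OF assms(1), of 0] assms(2) by (auto simp: poisson_zero)
  moreover have "(\<lambda>_. \<bar>ln (2 * R)\<bar>) absolutely_integrable_on {-pi..pi}"
    by (intro absolutely_integrable_continuous_real continuous_intros)
  \<comment> \<open>The absolute value in the bound covers the point \<open>rcis R t = a\<close>,
    where \<open>ln 0 = 0\<close> and ln (2 R) may be negative.\<close>
  moreover have "ln (norm (rcis R t - a)) \<le> \<bar>ln (2 * R)\<bar>" for t
  proof (cases "rcis R t = a")
    case False
    have "norm (rcis R t - a) \<le> 2 * R"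
      using norm_triangle_ineq4[of "rcis R t" a] assms by simp
    then have "ln (norm (rcis R t - a)) \<le> ln (2 * R)"
      using False assms by (subst ln_le_cancel_iff) (auto intro: less_le_trans[of 0 "norm (rcis R t - a)"])
    then show ?thesis
      by simp
  qed simp
  ultimately show ?thesis
    by (rule absolutely_integrable_absolutely_integrable_ubound)
qed

lemma ln_plus_eq: "x \<ge> 0 \<Longrightarrow> ln_plus x = (\<bar>ln x\<bar> + ln x) / 2"
proof (cases "x = 0")
  case False
  assume "x \<ge> 0"
  with False show ?thesis
    by (cases "x \<ge> 1") (auto simp: ln_plus_def max_def abs_if not_le)
qed (simp add: ln_plus_def)

lemma ln_plus_nonneg: "ln_plus x \<ge> 0"
  by (simp add: ln_plus_def)

text \<open>True for every function, because \<open>integral\<close> is 0 when the integrand is not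
  integrable.\<close>

lemma proximity_nonneg: "proximity R f \<ge> 0"
proof (cases "(\<lambda>t. ln_plus (norm (f (rcis R t)))) integrable_on {-pi..pi}")
  case True
  then show ?thesis
    unfolding proximity_def
    by (intro mult_nonneg_nonneg Henstock_Kurzweil_Integration.integral_nonneg) (auto simp: ln_plus_nonneg)
qed (simp add: proximity_def not_integrable_integral)

context nonzero_meromorphic
begin

lemma finite_circle_divisor: "R > 0 \<Longrightarrow> finite {t \<in> {-pi..pi}. rcis R t \<in> divisor R}"
proof -
  assume "R > 0"
  then have "finite (\<Union>a\<in>divisor R. {t \<in> {-pi..pi}. rcis R t = a})"
    by (intro finite_UN_I finite_divisor finite_rcis_eq)
  then show ?thesis
    by (rule rev_finite_subset) auto
qed

lemma absolutely_integrable_ln_norm: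
  assumes "R > 0"
  shows "(\<lambda>t. ln (norm (f (rcis R t)))) absolutely_integrable_on {-pi..pi}"
proof -
  obtain g where g: "g analytic_on cball 0 R" "\<And>z. norm z \<le> R \<Longrightarrow> g z \<noteq> 0"
    "\<And>z. norm z \<le> R \<Longrightarrow> z \<notin> divisor R \<Longrightarrow>
       ln (norm (f z)) = ln (norm (g z)) + (\<Sum>a\<in>divisor R. zorder f a * ln (norm (z - a)))"
    by (rule ln_norm_factorization[where R = R]) blast
  have "continuous_on (cball 0 R) g"
    using g(1) by (intro holomorphic_on_imp_continuous_on analytic_imp_holomorphic)
  then have "continuous_on {-pi..pi} (\<lambda>t. g (rcis R t))"
    by (rule continuous_on_compose2) (use assms in \<open>auto intro!: continuous_intros simp: rcis_def cis_conv_exp norm_mult\<close>)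
  then have "(\<lambda>t. ln (norm (g (rcis R t)))) absolutely_integrable_on {-pi..pi}"
    using g(2) assms by (intro absolutely_integrable_continuous_real continuous_intros) auto
  moreover have "(\<lambda>t. \<Sum>a\<in>divisor R. zorder f a * ln (norm (rcis R t - a))) absolutely_integrable_on {-pi..pi}"
    by (intro absolutely_integrable_sum finite_divisor set_integrable_mult_right
        absolutely_integrable_ln_norm_rcis_diff assms) (auto simp: divisor_def)
  ultimately have "(\<lambda>t. ln (norm (g (rcis R t))) + (\<Sum>a\<in>divisor R. zorder f a * ln (norm (rcis R t - a))))
      absolutely_integrable_on {-pi..pi}"
    by (rule set_integral_add)
  then show ?thesis
    by (rule absolutely_integrable_spike[of _ _ "{t \<in> {-pi..pi}. rcis R t \<in> divisor R}"])
       (use g(3) assms in \<open>auto intro!: negligible_finite finite_circle_divisor[simplified]\<close>)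
qed

text \<open>The Poisson formula is applied to g and to each factor of the factorization. The result
  is phrased through g so that it also serves when w is a zero or a pole: at w = 0 the limit in the
  second clause identifies g(0).\<close>

lemma Poisson_Jensen:
  assumes "norm w < R" 
  obtains g :: "complex \<Rightarrow> complex" where
    "norm w \<le> R \<Longrightarrow> w \<notin> divisor R \<Longrightarrow>
       ln (norm (f w)) = ln (norm (g w)) + (\<Sum>a\<in>divisor R. zorder f a * ln (norm (w - a)))"
    "((\<lambda>z. norm (f z) / norm z powi zorder f 0) \<longlongrightarrow>
       norm (g 0) * (\<Prod>a\<in>divisor R - {0}. norm a powi zorder f a)) (at 0)"
    "g 0 \<noteq> 0"
    "((\<lambda>t. ln (norm (f (rcis R t))) * poisson R w t) has_integral
       (2 * pi * (ln (norm (g w)) +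
         (\<Sum>a\<in>divisor R. zorder f a * ln (norm (of_real (R\<^sup>2) - cnj a * w) / R))))) {-pi..pi}"
proof -
  have "R > 0"
    using assms norm_ge_zero le_less_trans by blast
  obtain g where g: "g analytic_on cball 0 R" "\<And>z. norm z \<le> R \<Longrightarrow> g z \<noteq> 0"
    "\<And>z. norm z \<le> R \<Longrightarrow> z \<notin> divisor R \<Longrightarrow>
       ln (norm (f z)) = ln (norm (g z)) + (\<Sum>a\<in>divisor R. zorder f a * ln (norm (z - a)))"
    "((\<lambda>z. norm (f z) / norm z powi zorder f 0) \<longlongrightarrow>
       norm (g 0) * (\<Prod>a\<in>divisor R - {0}. norm a powi zorder f a)) (at 0)"
    by (rule ln_norm_factorization[where R = R]) (use \<open>R > 0\<close> in blast)
  have "((\<lambda>t. ln (norm (g (rcis R t))) * poisson R w t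
        + (\<Sum>a\<in>divisor R. zorder f a * (ln (norm (rcis R t - a)) * poisson R w t))) has_integral
       (2 * pi * ln (norm (g w)) +
         (\<Sum>a\<in>divisor R. zorder f a * (2 * pi * ln (norm (of_real (R\<^sup>2) - cnj a * w) / R))))) {-pi..pi}"
    by (intro has_integral_add has_integral_sum has_integral_mult_right finite_divisor
        Poisson_ln_norm g(1,2) Poisson_ln_norm_diff assms) (auto simp: divisor_def)
  also have "2 * pi * ln (norm (g w)) +
         (\<Sum>a\<in>divisor R. zorder f a * (2 * pi * ln (norm (of_real (R\<^sup>2) - cnj a * w) / R)))
      = 2 * pi * (ln (norm (g w)) +
         (\<Sum>a\<in>divisor R. zorder f a * ln (norm (of_real (R\<^sup>2) - cnj a * w) / R)))"
    by (simp add: distrib_left sum_distrib_left mult_ac)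
  finally have "((\<lambda>t. ln (norm (f (rcis R t))) * poisson R w t) has_integral
       (2 * pi * (ln (norm (g w)) +
         (\<Sum>a\<in>divisor R. zorder f a * ln (norm (of_real (R\<^sup>2) - cnj a * w) / R))))) {-pi..pi}"
    by (rule has_integral_spike_finite[OF finite_circle_divisor[OF \<open>R > 0\<close>], rotated])
       (use g(3) \<open>R > 0\<close> in \<open>auto simp: distrib_left sum_distrib_left mult_ac\<close>)
  with g \<open>R > 0\<close> that show thesis
    by auto
qed

text \<open>Together with the next lemma: the two proximity functions of f and 1/f have the circle
  mean of |ln |f|| as their sum and the circle mean of ln |f| as their difference.\<close>

lemma proximity_eq:
  assumes "R > 0"
  shows "proximity R f = 1 / (2 * pi) * ((integral {-pi..pi} (\<lambda>t. \<bar>ln (norm (f (rcis R t)))\<bar>)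
            + integral {-pi..pi} (\<lambda>t. ln (norm (f (rcis R t))))) / 2)"
proof -
  let ?L = "\<lambda>t. ln (norm (f (rcis R t)))"
  have "?L integrable_on {-pi..pi}" "(\<lambda>t. \<bar>?L t\<bar>) integrable_on {-pi..pi}"
    using absolutely_integrable_ln_norm[OF assms] by (auto simp: absolutely_integrable_on_def)
  then show ?thesis
    unfolding proximity_def by (simp add: ln_plus_eq Henstock_Kurzweil_Integration.integral_add)
qed

lemma proximity_inverse_eq:
  assumes "R > 0"
  shows "proximity R (\<lambda>z. 1 / f z) = 1 / (2 * pi) * ((integral {-pi..pi} (\<lambda>t. \<bar>ln (norm (f (rcis R t)))\<bar>)
            - integral {-pi..pi} (\<lambda>t. ln (norm (f (rcis R t))))) / 2)"
proof -
  have "ln (norm (1 / f z)) = - ln (norm (f z))" for z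
    by (cases "f z = 0") (auto simp: norm_divide ln_div)
  then show ?thesis
    using nonzero_meromorphic.proximity_eq[OF inverse_locale assms] by simp
qed

end


section \<open>Jensen's formula\<close>

text \<open>The contribution of one point of modulus \<alpha> > 0 to the integrated counting
  function: it is counted from t = \<alpha> on.\<close>

lemma has_integral_inverse_tail:
  fixes \<alpha> R :: real
  assumes "0 < \<alpha>" "\<alpha> \<le> R"
  shows "((\<lambda>t. if \<alpha> \<le> t then 1 / t else 0) has_integral ln (R / \<alpha>)) {0..R}"
proof -
  have "((\<lambda>t. 1 / t) has_integral (ln R - ln \<alpha>)) {\<alpha>..R}"
  proof (rule fundamental_theorem_of_calculus[OF assms(2)])
    fix x assume "x \<in> {\<alpha>..R}"
    then have "(ln has_real_derivative 1 / x) (at x within {\<alpha>..R})"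
      using assms by (auto intro!: derivative_eq_intros)
    then show "(ln has_vector_derivative 1 / x) (at x within {\<alpha>..R})"
      by (simp add: has_real_derivative_iff_has_vector_derivative)
  qed
  moreover have "{\<alpha>..R} \<subseteq> {0..R}"
    using assms by auto
  ultimately have "((\<lambda>t. if t \<in> {\<alpha>..R} then 1 / t else 0) has_integral (ln R - ln \<alpha>)) {0..R}"
    by (subst has_integral_restrict)
  then have "((\<lambda>t. if \<alpha> \<le> t then 1 / t else 0) has_integral (ln R - ln \<alpha>)) {0..R}"
    by (rule has_integral_eq[rotated]) auto
  then show ?thesis
    using assms by (simp add: ln_div)
qed

context nonzero_meromorphic
begin

lemma divisor_mono: "r \<le> R \<Longrightarrow> divisor r \<subseteq> divisor R"
  by (auto simp: divisor_def)

lemma pole_count_0: "pole_count 0 f = nat (- zorder f 0)"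
proof -
  have "divisor 0 = (if zorder f 0 = 0 then {} else {0})"
    by (auto simp: divisor_def)
  then show ?thesis
    by (simp add: pole_count_eq)
qed

text \<open>The integral over t is interchanged with the finite sum over the poles; a pole at 0 only
  enters the separate logarithmic term.\<close>

lemma integrated_count_eq:
  assumes "R > 0"
  shows "integrated_count R f = (\<Sum>a\<in>divisor R - {0}. real (nat (- zorder f a)) * ln (R / norm a))
           + real (nat (- zorder f 0)) * ln R"
proof -
  let ?m = "\<lambda>a. real (nat (- zorder f a))"
  have "((\<lambda>t. \<Sum>a\<in>divisor R - {0}. ?m a * (if norm a \<le> t then 1 / t else 0)) has_integral
      (\<Sum>a\<in>divisor R - {0}. ?m a * ln (R / norm a))) {0..R}"
    by (intro has_integral_sum has_integral_mult_right has_integral_inverse_tail finite_Diff finite_divisor)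
       (auto simp: divisor_def)
  moreover have "(\<Sum>a\<in>divisor R - {0}. ?m a * (if norm a \<le> t then 1 / t else 0))
      = (real (pole_count t f) - real (pole_count 0 f)) / t" if "t \<in> {0..R}" for t
  proof -
    have "real (pole_count t f) = (\<Sum>a\<in>divisor R. if norm a \<le> t then ?m a else 0)"
      unfolding pole_count_eq of_nat_sum using that
      by (intro sum.mono_neutral_cong_left finite_divisor) (auto simp: divisor_def)
    also have "\<dots> = (\<Sum>a\<in>divisor R - {0}. if norm a \<le> t then ?m a else 0) + ?m 0"
    proof (cases "0 \<in> divisor R")
      case True
      then show ?thesis
        using that by (subst sum.remove[OF finite_divisor True]) auto
    next
      case False
      then have "zorder f 0 = 0"
        using assms by (auto simp: divisor_def)
      then show ?thesis
        using False by simp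
    qed
    finally have "real (pole_count t f) - real (pole_count 0 f)
        = (\<Sum>a\<in>divisor R - {0}. if norm a \<le> t then ?m a else 0)"
      by (simp add: pole_count_0)
    then show ?thesis
      by (simp only: sum_divide_distrib) (intro sum.cong refl, simp)
  qed
  ultimately have "((\<lambda>t. (real (pole_count t f) - real (pole_count 0 f)) / t) has_integral
      (\<Sum>a\<in>divisor R - {0}. ?m a * ln (R / norm a))) {0..R}"
    by (rule has_integral_eq[rotated])
  from integral_unique[OF this] show ?thesis
    unfolding integrated_count_def pole_count_0 by simp
qed

lemma divisor_inverse: "nonzero_meromorphic.divisor (\<lambda>z. 1 / f z) r = divisor r"
  by (simp add: nonzero_meromorphic.divisor_def[OF inverse_locale] divisor_def zorder_inverse)

lemma integrated_count_inverse_eq: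
  assumes "R > 0"
  shows "integrated_count R (\<lambda>z. 1 / f z) = (\<Sum>a\<in>divisor R - {0}. real (nat (zorder f a)) * ln (R / norm a))
           + real (nat (zorder f 0)) * ln R"
  using nonzero_meromorphic.integrated_count_eq[OF inverse_locale assms]
  by (simp add: divisor_inverse zorder_inverse)

lemma integrated_count_nonneg: "R \<ge> 1 \<Longrightarrow> integrated_count R f \<ge> 0"
  by (subst integrated_count_eq)
     (auto intro!: add_nonneg_nonneg sum_nonneg mult_nonneg_nonneg simp: divisor_def field_simps)

lemma nevanlinna_T_nonneg: "R \<ge> 1 \<Longrightarrow> nevanlinna_T R f \<ge> 0"
  unfolding nevanlinna_T_def by (intro add_nonneg_nonneg integrated_count_nonneg proximity_nonneg)

text \<open>The Poisson-Jensen formula at the centre. The difference of the proximity functions is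
  the circle mean of ln |f|; the sums over the divisor in it cancel against the difference of the
  integrated counting functions. What remains is the logarithm of the modulus of the leading Laurent
  coefficient of f at 0.\<close>

lemma Jensen:
  obtains c where "\<And>R. R > 0 \<Longrightarrow> nevanlinna_T R f - nevanlinna_T R (\<lambda>z. 1 / f z) = c"
proof -
  define l where "l = Lim (at 0) (\<lambda>z. norm (f z) / norm z powi zorder f 0)"
  have "nevanlinna_T R f - nevanlinna_T R (\<lambda>z. 1 / f z) = ln l" if R: "R > 0" for R
  proof -
    let ?S = "divisor R"
    let ?p = "\<Prod>a\<in>?S - {0}. norm a powi zorder f a"
    obtain g :: "complex \<Rightarrow> complex" where g: "((\<lambda>z. norm (f z) / norm z powi zorder f 0) \<longlongrightarrow> norm (g 0) * ?p) (at 0)"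
      "g 0 \<noteq> 0"
      "((\<lambda>t. ln (norm (f (rcis R t))) * poisson R 0 t) has_integral
       (2 * pi * (ln (norm (g 0)) +
         (\<Sum>a\<in>?S. zorder f a * ln (norm (of_real (R\<^sup>2) - cnj a * 0) / R))))) {-pi..pi}"
      by (rule Poisson_Jensen[where R = R and w = 0]) (use R in auto)
    have int: "integral {-pi..pi} (\<lambda>t. ln (norm (f (rcis R t))))
        = 2 * pi * (ln (norm (g 0)) + (\<Sum>a\<in>?S. zorder f a * ln R))"
      using integral_unique[OF g(3)] R by (simp add: poisson_zero power2_eq_square norm_mult)
    have "l = norm (g 0) * ?p"
      unfolding l_def by (intro tendsto_Lim g(1)) auto
    moreover have "?p > 0"
      by (intro prod_pos) (auto intro!: zero_less_power_int)
    ultimately have "ln l = ln (norm (g 0)) + ln ?p"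
      using g(2) by (simp add: ln_mult)
    also have "ln ?p = (\<Sum>a\<in>?S - {0}. ln (norm a powi zorder f a))"
      using finite_divisor by (intro ln_prod) (auto intro!: zero_less_power_int)
    also have "\<dots> = (\<Sum>a\<in>?S - {0}. zorder f a * ln (norm a))"
      by (intro sum.cong ln_power_int) auto
    finally have l: "ln (norm (g 0)) = ln l - (\<Sum>a\<in>?S - {0}. zorder f a * ln (norm a))"
      by simp
    have sum: "(\<Sum>a\<in>?S. zorder f a * ln R) = (\<Sum>a\<in>?S - {0}. zorder f a * ln R) + zorder f 0 * ln R"
    proof (cases "0 \<in> ?S")
      case True
      then show ?thesis
        by (subst sum.remove[OF finite_divisor True]) auto
    next
      case False
      then have "zorder f 0 = 0"
        using R by (auto simp: divisor_def)
      then show ?thesis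
        using False by simp
    qed
    have "proximity R f - proximity R (\<lambda>z. 1 / f z) = 1 / (2 * pi) * integral {-pi..pi} (\<lambda>t. ln (norm (f (rcis R t))))"
      unfolding proximity_eq[OF R] proximity_inverse_eq[OF R] by (simp add: field_simps)
    also have "\<dots> = ln l + (\<Sum>a\<in>?S - {0}. zorder f a * (ln R - ln (norm a))) + zorder f 0 * ln R"
      unfolding int l sum by (simp add: right_diff_distrib sum_subtractf)
    also have "(\<Sum>a\<in>?S - {0}. zorder f a * (ln R - ln (norm a))) = (\<Sum>a\<in>?S - {0}. zorder f a * ln (R / norm a))"
      using R by (intro sum.cong) (auto simp: ln_div)
    finally have prox: "proximity R f - proximity R (\<lambda>z. 1 / f z)
        = ln l + (\<Sum>a\<in>?S - {0}. zorder f a * ln (R / norm a)) + zorder f 0 * ln R" .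
    have parts: "real (nat (- k)) = real (nat k) - real_of_int k" for k
      by simp
    have "integrated_count R f - integrated_count R (\<lambda>z. 1 / f z)
        = - (\<Sum>a\<in>?S - {0}. zorder f a * ln (R / norm a)) - zorder f 0 * ln R"
      unfolding integrated_count_eq[OF R] integrated_count_inverse_eq[OF R] parts
      by (simp add: left_diff_distrib sum_subtractf)
    with prox show ?thesis
      by (simp add: nevanlinna_T_def)
  qed
  then show thesis
    by (rule that)
qed

text \<open>Both bounds add the characteristics of f and 1/f, which differ by a constant. For the
  second one, every zero or pole of modulus at most R contributes at least ln \<gamma> per
  multiplicity to the integrated counting functions at radius \<gamma> R. The constant depends on f
  but not on \<gamma>.\<close>

lemma proximity_sum_le:
  obtains c where "\<And>R. R \<ge> 1 \<Longrightarrow> proximity R f + proximity R (\<lambda>z. 1 / f z) \<le> 2 * nevanlinna_T R f + c"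
    "\<And>R \<gamma>. R \<ge> 1 \<Longrightarrow> \<gamma> > 1 \<Longrightarrow> ln \<gamma> * zero_pole_count R f \<le> 2 * nevanlinna_T (\<gamma> * R) f + c"
proof -
  obtain c where c: "\<And>R. R > 0 \<Longrightarrow> nevanlinna_T R f - nevanlinna_T R (\<lambda>z. 1 / f z) = c"
    by (rule Jensen) blast
  have 1: "proximity R f + proximity R (\<lambda>z. 1 / f z) \<le> 2 * nevanlinna_T R f - c" if "R \<ge> 1" for R
    using c[of R] integrated_count_nonneg[OF that]
      nonzero_meromorphic.integrated_count_nonneg[OF inverse_locale that] that
    by (simp add: nevanlinna_T_def)
  have 2: "ln \<gamma> * zero_pole_count R f \<le> 2 * nevanlinna_T (\<gamma> * R) f - c" if R: "R \<ge> 1" "\<gamma> > 1" for R \<gamma>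
  proof -
    have "1 * 1 \<le> \<gamma> * R"
      using R by (intro mult_mono) auto
    then have gR: "\<gamma> * R \<ge> 1"
      by simp
    let ?m = "\<lambda>a. \<bar>real_of_int (zorder f a)\<bar>"
    have parts: "real (nat (- k)) = \<bar>real_of_int k\<bar> - real (nat k)" for k
      by simp
    have N: "integrated_count (\<gamma> * R) f + integrated_count (\<gamma> * R) (\<lambda>z. 1 / f z)
        = (\<Sum>a\<in>divisor (\<gamma> * R) - {0}. ?m a * ln (\<gamma> * R / norm a)) + ?m 0 * ln (\<gamma> * R)"
      using gR by (subst integrated_count_eq integrated_count_inverse_eq, simp)+
        (simp only: parts left_diff_distrib sum_subtractf)
    have "ln \<gamma> * zero_pole_count R f = (\<Sum>a\<in>divisor R. ?m a * ln \<gamma>)"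
      unfolding zero_pole_count_eq by (simp add: sum_distrib_left mult.commute)
    also have "\<dots> = (\<Sum>a\<in>divisor R - {0}. ?m a * ln \<gamma>) + ?m 0 * ln \<gamma>"
    proof (cases "0 \<in> divisor R")
      case True
      then show ?thesis
        by (subst sum.remove[OF finite_divisor True]) auto
    next
      case False
      then have "zorder f 0 = 0"
        using R by (auto simp: divisor_def)
      then show ?thesis
        using False by simp
    qed
    also have "\<dots> \<le> (\<Sum>a\<in>divisor (\<gamma> * R) - {0}. ?m a * ln (\<gamma> * R / norm a)) + ?m 0 * ln (\<gamma> * R)"
    proof (rule add_mono)
      have "(\<Sum>a\<in>divisor R - {0}. ?m a * ln \<gamma>) \<le> (\<Sum>a\<in>divisor R - {0}. ?m a * ln (\<gamma> * R / norm a))"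
      proof (intro sum_mono mult_left_mono)
        fix a assume "a \<in> divisor R - {0}"
        then have a: "norm a > 0" "norm a \<le> R"
          by (auto simp: divisor_def)
        then show "ln \<gamma> \<le> ln (\<gamma> * R / norm a)"
          using R by (subst ln_le_cancel_iff) (auto simp: field_simps)
      qed auto
      also have "\<dots> \<le> (\<Sum>a\<in>divisor (\<gamma> * R) - {0}. ?m a * ln (\<gamma> * R / norm a))"
      proof (intro sum_mono2)
        have "R \<le> \<gamma> * R"
          using R by simp
        then show "divisor R - {0} \<subseteq> divisor (\<gamma> * R) - {0}"
          using divisor_mono[of R "\<gamma> * R"] by auto
      qed (use finite_divisor in \<open>auto simp: divisor_def intro!: mult_nonneg_nonneg\<close>)
      finally show "(\<Sum>a\<in>divisor R - {0}. ?m a * ln \<gamma>) \<le> (\<Sum>a\<in>divisor (\<gamma> * R) - {0}. ?m a * ln (\<gamma> * R / norm a))" .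
      show "?m 0 * ln \<gamma> \<le> ?m 0 * ln (\<gamma> * R)"
        using R by (intro mult_left_mono) (auto simp: ln_mult)
    qed
    also have "\<dots> \<le> nevanlinna_T (\<gamma> * R) f + nevanlinna_T (\<gamma> * R) (\<lambda>z. 1 / f z)"
      unfolding N[symmetric] nevanlinna_T_def using proximity_nonneg by (simp add: add_nonneg_nonneg)
    also have "\<dots> = 2 * nevanlinna_T (\<gamma> * R) f - c"
      using c[of "\<gamma> * R"] gR by simp
    finally show ?thesis .
  qed
  show thesis
    by (rule that[of "- c"]) (use 1 2 in auto)
qed

end


section \<open>Comparing the values at two points\<close>

lemma ln_diff_le_divide:
  fixes x y :: real
  assumes "x > 0" "y \<ge> d" "d > 0" "\<bar>x - y\<bar> \<le> e"
  shows "ln x - ln y \<le> e / d"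
proof -
  have "ln x - ln y \<le> (x - y) / y"
    using assms by (intro ln_diff_le) auto
  also have "\<dots> \<le> e / d"
    using assms by (intro frac_le) auto
  finally show ?thesis .
qed

context nonzero_meromorphic
begin

lemma integral_abs_ln_norm:
  assumes "R > 0"
  shows "integral {-pi..pi} (\<lambda>t. \<bar>ln (norm (f (rcis R t)))\<bar>)
    = 2 * pi * (proximity R f + proximity R (\<lambda>z. 1 / f z))"
  unfolding proximity_eq[OF assms] proximity_inverse_eq[OF assms] by (simp add: field_simps)

lemma Poisson_Jensen':
  assumes "norm w < R" "f w \<noteq> 0"
  shows "((\<lambda>t. ln (norm (f (rcis R t))) * poisson R w t) has_integral
       (2 * pi * (ln (norm (f w)) + (\<Sum>a\<in>divisor R. zorder f a *
          (ln (norm (of_real (R\<^sup>2) - cnj a * w) / R) - ln (norm (w - a))))))) {-pi..pi}"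
proof -
  have "w \<notin> divisor R"
    using assms(2) by (auto simp: divisor_def eq_0_iff)
  obtain g :: "complex \<Rightarrow> complex" where g: "norm w \<le> R \<Longrightarrow> w \<notin> divisor R \<Longrightarrow>
       ln (norm (f w)) = ln (norm (g w)) + (\<Sum>a\<in>divisor R. zorder f a * ln (norm (w - a)))"
    "((\<lambda>t. ln (norm (f (rcis R t))) * poisson R w t) has_integral
       (2 * pi * (ln (norm (g w)) +
         (\<Sum>a\<in>divisor R. zorder f a * ln (norm (of_real (R\<^sup>2) - cnj a * w) / R))))) {-pi..pi}"
    by (rule Poisson_Jensen[OF assms(1)]) blast
  have "ln (norm (g w)) = ln (norm (f w)) - (\<Sum>a\<in>divisor R. zorder f a * ln (norm (w - a)))"
    using g(1) \<open>w \<notin> divisor R\<close> assms(1) by simp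
  with g(2) show ?thesis
    by (simp add: right_diff_distrib sum_subtractf algebra_simps)
qed

text \<open>The Poisson-Jensen formulas at w and v are subtracted. The three terms come from the
  difference of the kernels, from the reflected factors (R^2 - cnj a u) / R, which stay away from 0,
  and from the factors u - a, which need not.\<close>

lemma ln_norm_diff_le:
  assumes v: "norm v \<le> \<rho>" "f v \<noteq> 0" and w: "norm w \<le> \<rho>" "f w \<noteq> 0" and R: "\<rho> < R"
  shows "ln (norm (f w)) - ln (norm (f v)) \<le>
      2 * R * norm (w - v) / (R - \<rho>)\<^sup>2 * (proximity R f + proximity R (\<lambda>z. 1 / f z))
      + norm (w - v) / (R - \<rho>) * zero_pole_count R f
      + (\<Sum>a\<in>divisor R. \<bar>zorder f a\<bar> * (norm (w - v) / norm (v - a) + norm (w - v) / norm (w - a)))"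
proof -
  have "\<rho> \<ge> 0" "R > 0"
    using v(1) R norm_ge_zero by (meson order.trans le_less_trans)+
  let ?L = "\<lambda>t. ln (norm (f (rcis R t)))"
  let ?D = "\<lambda>a u. norm (of_real (R\<^sup>2) - cnj a * u) / R"
  let ?A = "\<lambda>u. \<Sum>a\<in>divisor R. zorder f a * (ln (?D a u) - ln (norm (u - a)))"
  let ?K = "2 * R * norm (w - v) / (R - \<rho>)\<^sup>2"
  have "((\<lambda>t. ?L t * poisson R w t - ?L t * poisson R v t) has_integral
      (2 * pi * (ln (norm (f w)) + ?A w) - 2 * pi * (ln (norm (f v)) + ?A v))) {-pi..pi}"
    using v w R by (intro has_integral_diff Poisson_Jensen') auto
  then have int: "((\<lambda>t. ?L t * (poisson R w t - poisson R v t)) has_integral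
      (2 * pi * (ln (norm (f w)) + ?A w) - 2 * pi * (ln (norm (f v)) + ?A v))) {-pi..pi}"
    by (simp add: right_diff_distrib)
  have abs: "(\<lambda>t. \<bar>?L t\<bar>) integrable_on {-pi..pi}"
    using absolutely_integrable_ln_norm[OF \<open>R > 0\<close>] by (auto simp: absolutely_integrable_on_def)
  have "norm (integral {-pi..pi} (\<lambda>t. ?L t * (poisson R w t - poisson R v t)))
      \<le> integral {-pi..pi} (\<lambda>t. ?K * \<bar>?L t\<bar>)"
  proof (rule integral_norm_bound_integral)
    show "(\<lambda>t. ?K * \<bar>?L t\<bar>) integrable_on {-pi..pi}"
      using abs by (rule integrable_on_mult_right)
    show "norm (?L t * (poisson R w t - poisson R v t)) \<le> ?K * \<bar>?L t\<bar>" for t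
      using mult_left_mono[OF poisson_diff_le[OF v(1) w(1) R, of t], of "\<bar>?L t\<bar>"]
      by (simp add: abs_mult mult_ac)
  qed (use int in auto)
  then have "2 * pi * ((ln (norm (f w)) + ?A w) - (ln (norm (f v)) + ?A v))
      \<le> 2 * pi * (?K * (proximity R f + proximity R (\<lambda>z. 1 / f z)))"
    unfolding integral_unique[OF int] integral_mult_right integral_abs_ln_norm[OF \<open>R > 0\<close>]
    by (simp add: right_diff_distrib mult_ac)
  then have "(ln (norm (f w)) + ?A w) - (ln (norm (f v)) + ?A v)
      \<le> ?K * (proximity R f + proximity R (\<lambda>z. 1 / f z))"
    by (rule mult_left_le_imp_le) simp
  moreover have "?A v - ?A w \<le> (\<Sum>a\<in>divisor R. \<bar>zorder f a\<bar> *
      (norm (w - v) / (R - \<rho>) + (norm (w - v) / norm (v - a) + norm (w - v) / norm (w - a))))"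
  proof -
    have step: "k * (ln (?D a v) - ln (norm (v - a))) - k * (ln (?D a w) - ln (norm (w - a))) \<le> \<bar>k\<bar> *
      (norm (w - v) / (R - \<rho>) + (norm (w - v) / norm (v - a) + norm (w - v) / norm (w - a)))"
      if a: "a \<in> divisor R" for a and k :: real
    proof -
      have "norm a \<le> R"
        using a by (simp add: divisor_def)
      \<comment> \<open>The reflected factor is bounded below because |cnj a u| <= R \<rho>.\<close>
      have Dge: "?D a u \<ge> R - \<rho>" if "norm u \<le> \<rho>" for u
      proof -
        have "R * (R - \<rho>) \<le> norm (complex_of_real (R\<^sup>2)) - norm (cnj a * u)"
          using mult_mono[OF \<open>norm a \<le> R\<close> that] \<open>R > 0\<close>
          by (simp only: norm_mult norm_of_real complex_mod_cnj abs_power2) (simp add: power2_eq_square right_diff_distrib)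
        also have "\<dots> \<le> norm (of_real (R\<^sup>2) - cnj a * u)"
          by (rule norm_triangle_ineq2)
        finally show ?thesis
          using \<open>R > 0\<close> by (simp add: field_simps)
      qed
      have Dd: "\<bar>?D a u - ?D a u'\<bar> \<le> norm (u - u')" for u u'
      proof -
        have "\<bar>norm (of_real (R\<^sup>2) - cnj a * u) - norm (of_real (R\<^sup>2) - cnj a * u')\<bar>
            \<le> norm ((of_real (R\<^sup>2) - cnj a * u) - (of_real (R\<^sup>2) - cnj a * u'))"
          by (rule norm_triangle_ineq3)
        also have "(of_real (R\<^sup>2) - cnj a * u) - (of_real (R\<^sup>2) - cnj a * u') = cnj a * (u' - u)"
          by (simp add: algebra_simps)
        also have "norm \<dots> \<le> R * norm (u - u')"
          using \<open>norm a \<le> R\<close> by (simp add: norm_mult norm_minus_commute mult_right_mono)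
        finally show ?thesis
          using \<open>R > 0\<close> by (simp add: field_simps flip: diff_divide_distrib)
      qed
      have D: "\<bar>ln (?D a v) - ln (?D a w)\<bar> \<le> norm (w - v) / (R - \<rho>)"
      proof (rule abs_leI)
        show "ln (?D a v) - ln (?D a w) \<le> norm (w - v) / (R - \<rho>)"
          using Dge[OF v(1)] Dge[OF w(1)] Dd[of v w] R
          by (intro ln_diff_le_divide) (auto simp: norm_minus_commute)
        have "ln (?D a w) - ln (?D a v) \<le> norm (w - v) / (R - \<rho>)"
          using Dge[OF v(1)] Dge[OF w(1)] Dd[of w v] R
          by (intro ln_diff_le_divide) (auto simp: norm_minus_commute)
        then show "- (ln (?D a v) - ln (?D a w)) \<le> norm (w - v) / (R - \<rho>)"
          by simp
      qed
      have ne: "v \<noteq> a" "w \<noteq> a"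
        using a v(2) w(2) by (auto simp: divisor_def eq_0_iff)
      have le: "\<bar>norm (w - a) - norm (v - a)\<bar> \<le> norm (w - v)"
        using norm_triangle_ineq3[of "w - a" "v - a"] by simp
      \<comment> \<open>Since orders of both signs occur, the difference of the logarithms is
        bounded in both directions; this is why the reciprocals of both distances appear.\<close>
      have "ln (norm (w - a)) - ln (norm (v - a)) \<le> norm (w - v) / norm (v - a)"
        using le ne by (intro ln_diff_le_divide) auto
      moreover have "ln (norm (v - a)) - ln (norm (w - a)) \<le> norm (w - v) / norm (w - a)"
        using le ne by (intro ln_diff_le_divide) auto
      moreover have "0 \<le> norm (w - v) / norm (v - a)" "0 \<le> norm (w - v) / norm (w - a)"
        by auto
      ultimately have N: "\<bar>ln (norm (w - a)) - ln (norm (v - a))\<bar> \<le> norm (w - v) / norm (v - a) + norm (w - v) / norm (w - a)"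
        by linarith
      have "k * (ln (?D a v) - ln (norm (v - a))) - k * (ln (?D a w) - ln (norm (w - a)))
          = k * ((ln (?D a v) - ln (?D a w)) + (ln (norm (w - a)) - ln (norm (v - a))))"
        by (simp add: algebra_simps)
      also have "\<dots> \<le> \<bar>k\<bar> * \<bar>(ln (?D a v) - ln (?D a w)) + (ln (norm (w - a)) - ln (norm (v - a)))\<bar>"
        by (metis abs_ge_self abs_mult)
      also have "\<dots> \<le> \<bar>k\<bar> * (norm (w - v) / (R - \<rho>) + (norm (w - v) / norm (v - a) + norm (w - v) / norm (w - a)))"
        using D N by (intro mult_left_mono) linarith+
      finally show ?thesis .
    qed
    show ?thesis
      unfolding sum_subtractf[symmetric] using step by (intro sum_mono) auto
  qed
  moreover have "(\<Sum>a\<in>divisor R. \<bar>zorder f a\<bar> *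
      (norm (w - v) / (R - \<rho>) + (norm (w - v) / norm (v - a) + norm (w - v) / norm (w - a))))
      = norm (w - v) / (R - \<rho>) * zero_pole_count R f
      + (\<Sum>a\<in>divisor R. \<bar>zorder f a\<bar> * (norm (w - v) / norm (v - a) + norm (w - v) / norm (w - a)))"
    unfolding zero_pole_count_eq distrib_left[of "of_int _"] sum.distrib sum_distrib_left by (simp add: mult.commute)
  ultimately show ?thesis
    by linarith
qed

end

section \<open>Angular lower bounds for distances from a ray\<close>

text \<open>A weak form of Jordan's inequality. Up to pi / 3 it follows from the mean value theorem
  and cos >= 1/2 >= 1 / pi; beyond that, sin x >= 1/2 >= x / pi.\<close>

lemma sin_ge_divide_pi:
  assumes "0 \<le> x" "x \<le> pi / 2"
  shows "x / pi \<le> sin x"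
proof (cases "x \<le> pi / 3")
  case True
  show ?thesis
  proof (cases "x = 0")
    case False
    then obtain y where y: "0 < y" "y < x" "sin x - sin 0 = (x - 0) * cos y"
      using MVT2[of 0 x sin cos] assms by (auto intro: DERIV_sin)
    have "cos (pi / 3) \<le> cos y"
      using y True by (intro cos_monotone_0_pi_le) auto
    moreover have "1 / pi \<le> 1 / 2"
      using pi_gt3 by (intro divide_left_mono) auto
    ultimately have "1 / pi \<le> cos y"
      unfolding cos_60 by linarith
    then have "x * (1 / pi) \<le> x * cos y"
      using assms by (intro mult_left_mono) auto
    then show ?thesis
      using y by simp
  qed simp
next
  case False
  have "x / pi \<le> 1 / 2"
    using assms by (simp add: field_simps)
  also have "1 / 2 = sin (pi / 6)"
    by (simp add: sin_30)
  also have "\<dots> \<le> sin x"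
    using False assms by (intro sin_monotone_2pi_le) auto
  finally show ?thesis .
qed

text \<open>Within distance pi / 2 of y there is one of the zeros -pi, 0, pi of the sine. The range
  is that of \<theta> / 2 - Arg p with \<theta> in [-pi, pi].\<close>

lemma abs_sin_ge:
  assumes "\<bar>y\<bar> \<le> 3 * pi / 2"
  shows "\<exists>k\<in>{-1, 0, 1}. \<bar>y - k * pi\<bar> / pi \<le> \<bar>sin y\<bar>"
proof -
  have base: "\<bar>u\<bar> / pi \<le> \<bar>sin u\<bar>" if "\<bar>u\<bar> \<le> pi / 2" for u
    using sin_ge_divide_pi[of "\<bar>u\<bar>"] that by (cases "u \<ge> 0") auto
  consider "\<bar>y\<bar> \<le> pi / 2" | "\<bar>y - pi\<bar> \<le> pi / 2" | "\<bar>y + pi\<bar> \<le> pi / 2"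
    using assms by linarith
  then show ?thesis
  proof cases
    case 1
    then show ?thesis
      using base[of y] by auto
  next
    case 2
    then show ?thesis
      using base[of "y - pi"] by auto
  next
    case 3
    then show ?thesis
      using base[of "y + pi"] by auto
  qed
qed

text \<open>Projecting radially bounds the distance from a ray to a point by an angular distance that does
  not depend on the position on the ray.\<close>

lemma norm_rcis_diff_ge:
  assumes "\<bar>\<theta>\<bar> \<le> pi" "s \<ge> 0"
  shows "\<exists>k\<in>{-1, 0, 1}. s / (2 * pi) * \<bar>\<theta> - (2 * Arg p + 2 * pi * k)\<bar> \<le> norm (rcis s (\<theta> / 2) - p)"
proof -
  define y where "y = \<theta> / 2 - Arg p"
  have "\<bar>y\<bar> \<le> 3 * pi / 2"
    using assms Arg_bounded[of p] unfolding y_def by linarith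
  then obtain k where k: "k \<in> {-1, 0, 1}" "\<bar>y - k * pi\<bar> / pi \<le> \<bar>sin y\<bar>"
    using abs_sin_ge by blast
  have "\<theta> - (2 * Arg p + 2 * pi * k) = 2 * (y - k * pi)"
    by (simp add: y_def algebra_simps)
  then have "s / (2 * pi) * \<bar>\<theta> - (2 * Arg p + 2 * pi * k)\<bar> = s * (\<bar>y - k * pi\<bar> / pi)"
    by (simp only: abs_mult) simp
  also have "\<dots> \<le> s * \<bar>sin y\<bar>"
    using k(2) assms by (intro mult_left_mono) auto
  \<comment> \<open>Rotating by -Arg p makes p real and nonnegative, so only the point of the ray
    contributes to the imaginary part.\<close>
  also have "\<dots> = \<bar>Im ((rcis s (\<theta> / 2) - p) * cis (- Arg p))\<bar>"
  proof -
    have "p * cis (- Arg p) = of_real (norm p)"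
      by (metis add.right_inverse cis_rcis_eq rcis_cmod_Arg rcis_mult mult.right_neutral rcis_zero_arg)
    moreover have "rcis s (\<theta> / 2) * cis (- Arg p) = rcis s y"
      by (simp add: rcis_def cis_mult y_def mult.assoc)
    ultimately show ?thesis
      using assms by (simp add: left_diff_distrib abs_mult)
  qed
  also have "\<dots> \<le> norm ((rcis s (\<theta> / 2) - p) * cis (- Arg p))"
    by (rule abs_Im_le_cmod)
  finally show ?thesis
    using k(1) by (auto simp: norm_mult)
qed

text \<open>The values of \<theta> for which the line through 0 with angle \<theta> / 2 can meet a
  preimage of a under z -> (z + i s)^2. The Boolean picks the square root of a, the integer picks
  the zero of the sine. Keeping the triple as an index lets coinciding angles be counted
  repeatedly.\<close>

definition critical_angle :: "real \<Rightarrow> complex \<times> bool \<times> int \<Rightarrow> real" where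
  "critical_angle s = (\<lambda>(a, b, k). 2 * Arg ((if b then csqrt a else - csqrt a) - \<i> * s) + 2 * pi * of_int k)"

text \<open>The difference factors as (z + i s - b) (z + i s + b) with b^2 = a. The two factors add
  up to 2 (z + i s), which has modulus at least sqrt r, so one of them is at least sqrt r / 2; the
  other one is bounded below by the angular estimate for rays.\<close>

lemma norm_shifted_square_diff_ge:
  assumes \<theta>: "\<bar>\<theta>\<bar> \<le> pi" and r: "2 * \<bar>s\<bar> \<le> sqrt r"
  defines "z \<equiv> rcis (sqrt r) (\<theta> / 2)"
  shows "\<exists>i\<in>UNIV \<times> {-1, 0, 1}. r / (4 * pi) * \<bar>\<theta> - critical_angle s (a, i)\<bar> \<le> norm ((z + \<i> * s)\<^sup>2 - a)"
proof -
  have "sqrt r \<ge> 0"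
    using r by linarith
  have nz: "norm z = sqrt r"
    using \<open>sqrt r \<ge> 0\<close> by (simp add: z_def)
  let ?d = "\<lambda>b. norm (z - ((if b then csqrt a else - csqrt a) - \<i> * s))"
  have fac: "norm ((z + \<i> * s)\<^sup>2 - a) = ?d True * ?d False"
  proof -
    have "(z + \<i> * s)\<^sup>2 - a = (z - (csqrt a - \<i> * s)) * (z - (- csqrt a - \<i> * s))"
      using power2_csqrt[of a] by (simp add: power2_eq_square algebra_simps)
    then show ?thesis
      by (simp add: norm_mult)
  qed
  have "sqrt r \<le> 2 * (norm z - norm (\<i> * of_real s))"
    using r nz by (simp add: norm_mult)
  also have "\<dots> \<le> 2 * norm (z + \<i> * s)"
    using norm_diff_ineq[of z "\<i> * of_real s"] by simp
  also have "\<dots> = norm (2 * (z + \<i> * s))"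
    unfolding norm_mult[of 2] by simp
  also have "2 * (z + \<i> * s) = (z - (csqrt a - \<i> * s)) + (z - (- csqrt a - \<i> * s))"
    by (simp add: algebra_simps)
  also have "norm \<dots> \<le> ?d True + ?d False"
    by (rule order.trans[OF norm_triangle_ineq]) simp
  finally have "sqrt r / 2 \<le> ?d True \<or> sqrt r / 2 \<le> ?d False"
    by linarith
  then have "\<exists>b. sqrt r / 2 * ?d b \<le> ?d True * ?d False"
  proof
    assume "sqrt r / 2 \<le> ?d True"
    then have "sqrt r / 2 * ?d False \<le> ?d True * ?d False"
      by (rule mult_right_mono) (rule norm_ge_zero)
    then show ?thesis ..
  next
    assume "sqrt r / 2 \<le> ?d False"
    then have "?d True * (sqrt r / 2) \<le> ?d True * ?d False"
      by (rule mult_left_mono) (rule norm_ge_zero)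
    then have "sqrt r / 2 * ?d True \<le> ?d True * ?d False"
      by (simp only: mult.commute)
    then show ?thesis ..
  qed
  then obtain b where b: "sqrt r / 2 * ?d b \<le> ?d True * ?d False" ..
  obtain k :: real where k: "k \<in> {-1, 0, 1}" and
    kd: "sqrt r / (2 * pi) * \<bar>\<theta> - (2 * Arg ((if b then csqrt a else - csqrt a) - \<i> * s) + 2 * pi * k)\<bar> \<le> ?d b"
    using norm_rcis_diff_ge[OF \<theta> \<open>sqrt r \<ge> 0\<close>] unfolding z_def by blast
  obtain k' :: int where k': "k' \<in> {-1, 0, 1}" "k = of_int k'"
    using k by (metis insert_iff of_int_0 of_int_1 of_int_minus singletonD)
  have "r / (4 * pi) * \<bar>\<theta> - critical_angle s (a, b, k')\<bar>
      = sqrt r / 2 * (sqrt r / (2 * pi) * \<bar>\<theta> - critical_angle s (a, b, k')\<bar>)"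
    using \<open>sqrt r \<ge> 0\<close> by (simp add: field_simps)
  also have "\<dots> \<le> sqrt r / 2 * ?d b"
    using kd \<open>sqrt r \<ge> 0\<close> k'(2) by (intro mult_left_mono) (auto simp: critical_angle_def)
  also have "\<dots> \<le> norm ((z + \<i> * s)\<^sup>2 - a)"
    unfolding fac by (rule b)
  finally show ?thesis
    using k' by blast
qed

lemma abs_critical_angle_le: "k \<in> {-1, 0, 1} \<Longrightarrow> \<bar>critical_angle s (a, b, k)\<bar> \<le> 4 * pi"
  using Arg_bounded[of "csqrt a - \<i> * s"] Arg_bounded[of "- csqrt a - \<i> * s"]
  by (auto simp: critical_angle_def)


section \<open>Sums of inverse distances on the real line\<close>

lemma nn_integral_inverse_dist_le:
  fixes c \<delta> L :: real
  assumes "\<delta> > 0" "L \<ge> 0"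
  shows "(\<integral>\<^sup>+x. ennreal (1 / (\<delta> + \<bar>x - c\<bar>)) * indicator {c - L..c + L} x \<partial>lborel) \<le> ennreal (2 * ln (1 + L / \<delta>))"
proof -
  let ?f = "\<lambda>x. 1 / (\<delta> + \<bar>x - c\<bar>)"
  have "1 + L / \<delta> = (\<delta> + L) / \<delta>"
    using assms by (simp add: field_simps)
  then have ln: "ln (1 + L / \<delta>) = ln (\<delta> + L) - ln \<delta>"
    using assms by (simp add: ln_div)
  have "(\<integral>\<^sup>+x. ennreal (?f x) * indicator {c..c + L} x \<partial>lborel) = ennreal (ln (\<delta> + (c + L - c)) - ln (\<delta> + (c - c)))"
  proof (rule nn_integral_FTC_Icc)
    show "DERIV (\<lambda>x. ln (\<delta> + (x - c))) x :> ?f x" if "x \<in> {c..c + L}" for x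
      using that assms by (auto intro!: derivative_eq_intros simp: field_simps)
  qed (use assms in auto)
  also have "\<dots> = ennreal (ln (1 + L / \<delta>))"
    unfolding ln by simp
  finally have 1: "(\<integral>\<^sup>+x. ennreal (?f x) * indicator {c..c + L} x \<partial>lborel) = ennreal (ln (1 + L / \<delta>))" .
  have "(\<integral>\<^sup>+x. ennreal (?f x) * indicator {c - L..c} x \<partial>lborel) = ennreal (- ln (\<delta> - (c - c)) - (- ln (\<delta> - (c - L - c))))"
  proof (rule nn_integral_FTC_Icc)
    show "DERIV (\<lambda>x. - ln (\<delta> - (x - c))) x :> ?f x" if "x \<in> {c - L..c}" for x
      using that assms by (auto intro!: derivative_eq_intros simp: field_simps)
  qed (use assms in auto)
  also have "\<dots> = ennreal (ln (1 + L / \<delta>))"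
    unfolding ln by simp
  finally have 2: "(\<integral>\<^sup>+x. ennreal (?f x) * indicator {c - L..c} x \<partial>lborel) = ennreal (ln (1 + L / \<delta>))" .
  have "(\<integral>\<^sup>+x. ennreal (?f x) * indicator {c - L..c + L} x \<partial>lborel)
      \<le> (\<integral>\<^sup>+x. ennreal (?f x) * indicator {c - L..c} x + ennreal (?f x) * indicator {c..c + L} x \<partial>lborel)"
    by (intro nn_integral_mono) (auto split: split_indicator)
  also have "\<dots> = ennreal (ln (1 + L / \<delta>)) + ennreal (ln (1 + L / \<delta>))"
    unfolding 1[symmetric] by (subst nn_integral_add) (use 1 2 in auto)
  also have "\<dots> = ennreal (2 * ln (1 + L / \<delta>))"
    using assms by (subst ennreal_plus[symmetric]) auto
  finally show ?thesis .
qed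

text \<open>Off the \<open>\<delta>\<close>-neighbourhoods of the points, the singular sum is at most twice its regularisation by
  \<open>\<delta>\<close>, which is integrable; Markov's inequality does the rest.\<close>

lemma sum_inverse_dist_exceptional_set:
  fixes I :: "'i set" and m c :: "'i \<Rightarrow> real"
  assumes "finite I" and m: "\<And>i. i \<in> I \<Longrightarrow> m i \<ge> 1" and c: "\<And>i. i \<in> I \<Longrightarrow> \<bar>c i\<bar> \<le> L" and "H > 0"
  defines "n \<equiv> \<Sum>i\<in>I. m i"
  obtains E where "E \<in> sets lborel" "emeasure lborel E \<le> ennreal (3 * H)"
    "\<And>\<theta>. \<bar>\<theta>\<bar> \<le> pi \<Longrightarrow> \<theta> \<notin> E \<Longrightarrow> \<theta> \<notin> c ` I \<and>
       (\<Sum>i\<in>I. m i / \<bar>\<theta> - c i\<bar>) \<le> 4 * (n / H) * ln (1 + (L + pi) * (n / H))"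
proof (cases "I = {}")
  case True
  then show thesis
    using that[of "{}"] by (simp add: n_def)
next
  case False
  then obtain i0 where "i0 \<in> I"
    by blast
  then have "L \<ge> 0"
    using c[of i0] by linarith
  have card: "real (card I) \<le> n"
    unfolding n_def using sum_mono[of I "\<lambda>_. 1" m] m by simp
  have "card I > 0"
    using False \<open>finite I\<close> by (simp add: card_gt_0_iff)
  then have "n > 0"
    using card by linarith
  \<comment> \<open>With this radius the neighbourhoods of the points have total length at most 2 H,
    as every weight is at least 1 and so there are at most n points.\<close>
  define \<delta> where "\<delta> = H / n"
  have "\<delta> > 0"
    using \<open>n > 0\<close> \<open>H > 0\<close> by (simp add: \<delta>_def)
  \<comment> \<open>Every point of [-pi, pi] is within L + pi of each \<open>c i\<close>.\<close>
  define L' where "L' = L + pi"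
  have "L' > 0"
    using \<open>L \<ge> 0\<close> pi_gt_zero unfolding L'_def by linarith
  define A where "A = ln (1 + L' / \<delta>)"
  have "A > 0"
    unfolding A_def using \<open>L' > 0\<close> \<open>\<delta> > 0\<close> by (intro ln_gt_zero) simp
  \<comment> \<open>The integral of \<open>g\<close> over [-pi, pi] will be at most 4 n A = M H, so
    the set where \<open>g\<close> exceeds M has measure at most H.\<close>
  define M where "M = 4 * (n / H) * A"
  have "M > 0"
    using \<open>A > 0\<close> \<open>n > 0\<close> \<open>H > 0\<close> by (simp add: M_def)
  \<comment> \<open>The regularised sum; the factor 2 comes from 1 / x <= 2 / (\<delta> + x) for x
    >= \<delta>.\<close>
  define g where "g = (\<lambda>\<theta>. \<Sum>i\<in>I. m i * (2 / (\<delta> + \<bar>\<theta> - c i\<bar>)))"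
  define E1 where "E1 = (\<Union>i\<in>I. {c i - \<delta><..<c i + \<delta>})"
  define E2 where "E2 = {\<theta> \<in> {-pi..pi}. 1 \<le> ennreal (1 / M) * ennreal (g \<theta>)}"
  have gmeas[measurable]: "g \<in> borel_measurable borel"
    unfolding g_def by measurable
  have E1s: "E1 \<in> sets lborel"
    unfolding E1_def using \<open>finite I\<close> by auto
  have E2s: "E2 \<in> sets lborel"
    unfolding E2_def by measurable
  have "emeasure lborel E1 \<le> (\<Sum>i\<in>I. emeasure lborel {c i - \<delta><..<c i + \<delta>})"
    unfolding E1_def using \<open>finite I\<close> by (intro emeasure_subadditive_finite) auto
  also have "\<dots> = (\<Sum>i\<in>I. ennreal (2 * \<delta>))"
    using \<open>\<delta> > 0\<close> by (intro sum.cong) auto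
  also have "\<dots> = ennreal (real (card I) * (2 * \<delta>))"
    using \<open>\<delta> > 0\<close> by (simp add: ennreal_mult ennreal_of_nat_eq_real_of_nat)
  also have "\<dots> \<le> ennreal (n * (2 * \<delta>))"
    using card \<open>\<delta> > 0\<close> by (intro ennreal_leI mult_right_mono) auto
  also have "n * (2 * \<delta>) = 2 * H"
    using \<open>n > 0\<close> by (simp add: \<delta>_def)
  finally have E1: "emeasure lborel E1 \<le> ennreal (2 * H)" .
  have "(\<integral>\<^sup>+\<theta>. ennreal (g \<theta>) * indicator {-pi..pi} \<theta> \<partial>lborel)
      = (\<integral>\<^sup>+\<theta>. (\<Sum>i\<in>I. ennreal (2 * m i) * (ennreal (1 / (\<delta> + \<bar>\<theta> - c i\<bar>)) * indicator {-pi..pi} \<theta>)) \<partial>lborel)"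
  proof (rule nn_integral_cong)
    fix \<theta> :: real
    have "m i * (2 / (\<delta> + \<bar>\<theta> - c i\<bar>)) \<ge> 0" if "i \<in> I" for i
      using m[OF that] \<open>\<delta> > 0\<close> by (intro mult_nonneg_nonneg) auto
    then have "ennreal (g \<theta>) = (\<Sum>i\<in>I. ennreal (m i * (2 / (\<delta> + \<bar>\<theta> - c i\<bar>))))"
      unfolding g_def by (rule sum_ennreal[symmetric])
    also have "\<dots> = (\<Sum>i\<in>I. ennreal (2 * m i) * ennreal (1 / (\<delta> + \<bar>\<theta> - c i\<bar>)))"
    proof (rule sum.cong)
      fix i assume "i \<in> I"
      then have "m i * (2 / (\<delta> + \<bar>\<theta> - c i\<bar>)) = (2 * m i) * (1 / (\<delta> + \<bar>\<theta> - c i\<bar>))" "2 * m i \<ge> 0"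
        using m[of i] by auto
      then show "ennreal (m i * (2 / (\<delta> + \<bar>\<theta> - c i\<bar>))) = ennreal (2 * m i) * ennreal (1 / (\<delta> + \<bar>\<theta> - c i\<bar>))"
        by (simp only: ennreal_mult')
    qed auto
    finally show "ennreal (g \<theta>) * indicator {-pi..pi} \<theta>
        = (\<Sum>i\<in>I. ennreal (2 * m i) * (ennreal (1 / (\<delta> + \<bar>\<theta> - c i\<bar>)) * indicator {-pi..pi} \<theta>))"
      by (simp add: sum_distrib_right mult.assoc)
  qed
  also have "\<dots> = (\<Sum>i\<in>I. ennreal (2 * m i) * (\<integral>\<^sup>+\<theta>. ennreal (1 / (\<delta> + \<bar>\<theta> - c i\<bar>)) * indicator {-pi..pi} \<theta> \<partial>lborel))"
    by (simp add: nn_integral_sum nn_integral_cmult)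
  also have "\<dots> \<le> (\<Sum>i\<in>I. ennreal (2 * m i) * ennreal (2 * A))"
  proof (intro sum_mono mult_left_mono)
    fix i assume "i \<in> I"
    then have "indicator {-pi..pi} \<theta> \<le> (indicator {c i - L'..c i + L'} \<theta> :: ennreal)" for \<theta>
      using c[of i] by (auto simp: L'_def split: split_indicator)
    then have "(\<integral>\<^sup>+\<theta>. ennreal (1 / (\<delta> + \<bar>\<theta> - c i\<bar>)) * indicator {-pi..pi} \<theta> \<partial>lborel)
        \<le> (\<integral>\<^sup>+\<theta>. ennreal (1 / (\<delta> + \<bar>\<theta> - c i\<bar>)) * indicator {c i - L'..c i + L'} \<theta> \<partial>lborel)"
      by (intro nn_integral_mono mult_left_mono) auto
    also have "\<dots> \<le> ennreal (2 * A)"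
      unfolding A_def using \<open>\<delta> > 0\<close> \<open>L' > 0\<close> by (intro nn_integral_inverse_dist_le) auto
    finally show "(\<integral>\<^sup>+\<theta>. ennreal (1 / (\<delta> + \<bar>\<theta> - c i\<bar>)) * indicator {-pi..pi} \<theta> \<partial>lborel) \<le> ennreal (2 * A)" .
  qed auto
  also have "\<dots> = ennreal (\<Sum>i\<in>I. 2 * m i * (2 * A))"
  proof -
    have "2 * m i * (2 * A) \<ge> 0" if "i \<in> I" for i
      using m[OF that] \<open>A > 0\<close> by (intro mult_nonneg_nonneg) auto
    then have "ennreal (\<Sum>i\<in>I. 2 * m i * (2 * A)) = (\<Sum>i\<in>I. ennreal (2 * m i * (2 * A)))"
      by (rule sum_ennreal[symmetric])
    also have "\<dots> = (\<Sum>i\<in>I. ennreal (2 * m i) * ennreal (2 * A))"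
      using \<open>A > 0\<close> by (intro sum.cong ennreal_mult'') auto
    finally show ?thesis ..
  qed
  also have "(\<Sum>i\<in>I. 2 * m i * (2 * A)) = M * H"
    using \<open>H > 0\<close> unfolding M_def n_def sum_distrib_right[symmetric] sum_distrib_left[symmetric] by simp
  finally have int: "(\<integral>\<^sup>+\<theta>. ennreal (g \<theta>) * indicator {-pi..pi} \<theta> \<partial>lborel) \<le> ennreal (M * H)" .
  have "emeasure lborel E2 \<le> ennreal (1 / M) * (\<integral>\<^sup>+\<theta>. ennreal (g \<theta>) * indicator {-pi..pi} \<theta> \<partial>lborel)"
    unfolding E2_def by (rule nn_integral_Markov_inequality) auto
  also have "\<dots> \<le> ennreal (1 / M) * ennreal (M * H)"
    by (intro mult_left_mono int) auto
  also have "\<dots> = ennreal H"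
    using \<open>M > 0\<close> \<open>H > 0\<close> by (simp add: ennreal_mult'[symmetric])
  finally have E2: "emeasure lborel E2 \<le> ennreal H" .
  show thesis
  proof (rule that[of "E1 \<union> E2"])
    have "emeasure lborel (E1 \<union> E2) \<le> ennreal (2 * H) + ennreal H"
      using emeasure_subadditive[OF E1s E2s] add_mono[OF E1 E2] by (rule order.trans)
    also have "\<dots> = ennreal (3 * H)"
      using \<open>H > 0\<close> by (subst ennreal_plus[symmetric]) auto
    finally show "emeasure lborel (E1 \<union> E2) \<le> ennreal (3 * H)" .
    fix \<theta> :: real assume \<theta>: "\<bar>\<theta>\<bar> \<le> pi" "\<theta> \<notin> E1 \<union> E2"
    have far: "\<delta> \<le> \<bar>\<theta> - c i\<bar>" if "i \<in> I" for i
      using \<theta>(2) that by (auto simp: E1_def abs_if not_less)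
    have "(\<Sum>i\<in>I. m i / \<bar>\<theta> - c i\<bar>) \<le> g \<theta>"
      unfolding g_def
    proof (intro sum_mono)
      fix i assume i: "i \<in> I"
      have "1 / \<bar>\<theta> - c i\<bar> \<le> 2 / (\<delta> + \<bar>\<theta> - c i\<bar>)"
        using far[OF i] \<open>\<delta> > 0\<close> by (simp add: field_simps)
      then show "m i / \<bar>\<theta> - c i\<bar> \<le> m i * (2 / (\<delta> + \<bar>\<theta> - c i\<bar>))"
        using mult_left_mono[of "1 / \<bar>\<theta> - c i\<bar>" "2 / (\<delta> + \<bar>\<theta> - c i\<bar>)" "m i"] m[OF i] by simp
    qed
    also have "g \<theta> \<le> M"
    proof (rule ccontr)
      assume "\<not> g \<theta> \<le> M"
      then have "1 \<le> 1 / M * g \<theta>"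
        using \<open>M > 0\<close> by simp
      then have "ennreal 1 \<le> ennreal (1 / M * g \<theta>)"
        by (rule ennreal_leI)
      then have "1 \<le> ennreal (1 / M) * ennreal (g \<theta>)"
        using \<open>M > 0\<close> by (subst ennreal_mult'[symmetric]) auto
      then show False
        using \<theta> by (auto simp: E2_def)
    qed
    also have "M = 4 * (n / H) * ln (1 + (L + pi) * (n / H))"
      by (simp add: M_def A_def L'_def \<delta>_def)
    finally show "\<theta> \<notin> c ` I \<and> (\<Sum>i\<in>I. m i / \<bar>\<theta> - c i\<bar>) \<le> 4 * (n / H) * ln (1 + (L + pi) * (n / H))"
      using far \<open>\<delta> > 0\<close> by force
  qed (use E1s E2s in auto)
qed

text \<open>Borel-Cantelli for exceptional sets of measure O(k^(-q)), summable because q > 1. The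
  sets are indexed from \<open>Suc k\<close>, since \<open>0 powr (- q) = 0\<close> is not an
  admissible H.\<close>

lemma AE_sum_inverse_dist_le:
  fixes I :: "nat \<Rightarrow> 'i set" and m c :: "'i \<Rightarrow> real"
  assumes fin: "\<And>k. finite (I k)" and m: "\<And>k i. i \<in> I k \<Longrightarrow> m i \<ge> 1"
    and c: "\<And>k i. i \<in> I k \<Longrightarrow> \<bar>c i\<bar> \<le> L" and q: "q > 1"
  shows "AE \<theta> in lborel. \<bar>\<theta>\<bar> \<le> pi \<longrightarrow> (\<forall>\<^sub>F k in sequentially. \<theta> \<notin> c ` I k \<and>
     (\<Sum>i\<in>I k. m i / \<bar>\<theta> - c i\<bar>)
       \<le> 4 * (sum m (I k) * real k powr q) * ln (1 + (L + pi) * (sum m (I k) * real k powr q)))"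
proof -
  define H where "H = (\<lambda>k. real (Suc k) powr (- q))"
  have Hpos: "H k > 0" for k
    by (simp add: H_def)
  define P where "P = (\<lambda>k E. E \<in> sets lborel \<and> emeasure lborel E \<le> ennreal (3 * H k) \<and>
    (\<forall>\<theta>. \<bar>\<theta>\<bar> \<le> pi \<longrightarrow> \<theta> \<notin> E \<longrightarrow> \<theta> \<notin> c ` I (Suc k) \<and>
       (\<Sum>i\<in>I (Suc k). m i / \<bar>\<theta> - c i\<bar>)
         \<le> 4 * (sum m (I (Suc k)) / H k) * ln (1 + (L + pi) * (sum m (I (Suc k)) / H k))))"
  have "\<exists>E. P k E" for k
  proof -
    obtain E where "E \<in> sets lborel" "emeasure lborel E \<le> ennreal (3 * H k)"
      "\<And>\<theta>. \<bar>\<theta>\<bar> \<le> pi \<Longrightarrow> \<theta> \<notin> E \<Longrightarrow> \<theta> \<notin> c ` I (Suc k) \<and>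
       (\<Sum>i\<in>I (Suc k). m i / \<bar>\<theta> - c i\<bar>)
         \<le> 4 * (sum m (I (Suc k)) / H k) * ln (1 + (L + pi) * (sum m (I (Suc k)) / H k))"
      by (rule sum_inverse_dist_exceptional_set[of "I (Suc k)" m c L "H k"])
         (use fin m c Hpos in blast)+
    then show ?thesis
      unfolding P_def by blast
  qed
  then have "\<exists>E. \<forall>k. P k (E k)"
    by (intro choice allI)
  then obtain E where "\<And>k. P k (E k)"
    by blast
  then have E: "\<And>k. E k \<in> sets lborel" "\<And>k. emeasure lborel (E k) \<le> ennreal (3 * H k)"
    "\<And>k \<theta>. \<bar>\<theta>\<bar> \<le> pi \<Longrightarrow> \<theta> \<notin> E k \<Longrightarrow> \<theta> \<notin> c ` I (Suc k) \<and>
       (\<Sum>i\<in>I (Suc k). m i / \<bar>\<theta> - c i\<bar>)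
         \<le> 4 * (sum m (I (Suc k)) / H k) * ln (1 + (L + pi) * (sum m (I (Suc k)) / H k))"
    unfolding P_def by blast+
  have fin_E: "emeasure lborel (E k) < \<infinity>" for k
    using E(2)[of k] by (rule le_less_trans) simp
  have "summable (\<lambda>k. measure lborel (E k))"
  proof (rule summable_comparison_test')
    have "summable (\<lambda>k. real k powr (- q))"
      using q by (simp add: summable_real_powr_iff)
    then show "summable (\<lambda>k. 3 * H k)"
      unfolding H_def by (intro summable_mult) (simp only: summable_Suc_iff[of "\<lambda>k. real k powr (- q)"])
    show "norm (measure lborel (E k)) \<le> 3 * H k" if "k \<ge> 0" for k
    proof -
      have "measure lborel (E k) \<le> 3 * H k"
        unfolding measure_def by (rule enn2real_leI[OF _ E(2)]) (use Hpos[of k] in simp)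
      then show ?thesis
        by simp
    qed
  qed
  from borel_cantelli_AE1[OF E(1) fin_E this]
  show ?thesis
  proof eventually_elim
    case (elim \<theta>)
    show ?case
    proof
      assume \<theta>: "\<bar>\<theta>\<bar> \<le> pi"
      have "x / H k = x * real (Suc k) powr q" for x k
        by (simp add: H_def powr_minus divide_inverse)
      note E' = E(3)[unfolded this]
      have "\<forall>\<^sub>F k in sequentially. \<theta> \<notin> c ` I (Suc k) \<and>
         (\<Sum>i\<in>I (Suc k). m i / \<bar>\<theta> - c i\<bar>)
           \<le> 4 * (sum m (I (Suc k)) * real (Suc k) powr q) * ln (1 + (L + pi) * (sum m (I (Suc k)) * real (Suc k) powr q))"
        using elim by eventually_elim (use E' \<theta> in auto)
      then show "\<forall>\<^sub>F k in sequentially. \<theta> \<notin> c ` I k \<and>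
         (\<Sum>i\<in>I k. m i / \<bar>\<theta> - c i\<bar>)
           \<le> 4 * (sum m (I k) * real k powr q) * ln (1 + (L + pi) * (sum m (I k) * real k powr q))"
        by (simp only: eventually_sequentially_Suc[of "\<lambda>k. \<theta> \<notin> c ` I k \<and>
         (\<Sum>i\<in>I k. m i / \<bar>\<theta> - c i\<bar>)
           \<le> 4 * (sum m (I k) * real k powr q) * ln (1 + (L + pi) * (sum m (I k) * real k powr q))"])
    qed
  qed
qed


section \<open>Sums over zeros and poles\<close>

definition critical_index :: "real \<Rightarrow> (complex \<Rightarrow> complex) \<Rightarrow> (complex \<times> bool \<times> int) set" where
  "critical_index \<rho> f = {a. norm a \<le> \<rho> \<and> zorder f a \<noteq> 0} \<times> UNIV \<times> {-1, 0, 1}"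

text \<open>At a critical angle the offending term is \<open>x / 0 = 0\<close>; hence every use of a
  bound on this sum comes with the condition that \<theta> is not critical.\<close>

definition critical_sum :: "real \<Rightarrow> real \<Rightarrow> (complex \<Rightarrow> complex) \<Rightarrow> real \<Rightarrow> real" where
  "critical_sum s \<rho> f \<theta> = (\<Sum>i\<in>critical_index \<rho> f. \<bar>zorder f (fst i)\<bar> / \<bar>\<theta> - critical_angle s i\<bar>)"

context nonzero_meromorphic
begin

lemma critical_index_eq: "critical_index \<rho> f = divisor \<rho> \<times> UNIV \<times> {-1, 0, 1}"
  by (simp add: critical_index_def divisor_def)

lemma finite_critical_index: "finite (critical_index \<rho> f)"
  by (auto simp: critical_index_eq finite_divisor)

lemma sum_critical_index: "(\<Sum>i\<in>critical_index \<rho> f. \<bar>real_of_int (zorder f (fst i))\<bar>) = 6 * zero_pole_count \<rho> f"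
proof -
  have "(\<Sum>i\<in>critical_index \<rho> f. \<bar>real_of_int (zorder f (fst i))\<bar>)
      = (\<Sum>a\<in>divisor \<rho>. \<Sum>i\<in>(UNIV :: bool set) \<times> {-1, 0, 1 :: int}. \<bar>real_of_int (zorder f a)\<bar>)"
    unfolding critical_index_eq sum.cartesian_product by (intro sum.cong) auto
  also have "\<dots> = (\<Sum>a\<in>divisor \<rho>. 6 * \<bar>real_of_int (zorder f a)\<bar>)"
    by (simp add: card_cartesian_product)
  finally show ?thesis
    by (simp add: zero_pole_count_eq sum_distrib_left)
qed

lemma zero_pole_count_mono: "r \<le> R \<Longrightarrow> real (zero_pole_count r f) \<le> zero_pole_count R f"
  unfolding zero_pole_count_eq by (intro sum_mono2 finite_divisor divisor_mono) auto

text \<open>If the point p were a zero or a pole, the angular lower bound with a = p would have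
  distance 0 on its right, which forces \<theta> to be a critical angle.\<close>

lemma shifted_square_not_divisor:
  assumes "\<bar>\<theta>\<bar> \<le> pi" "2 * \<bar>s\<bar> \<le> sqrt r" "r > 0" "\<theta> \<notin> critical_angle s ` critical_index \<rho> f"
    and "norm ((rcis (sqrt r) (\<theta> / 2) + \<i> * s)\<^sup>2) \<le> \<rho>"
  shows "f ((rcis (sqrt r) (\<theta> / 2) + \<i> * s)\<^sup>2) \<noteq> 0"
proof
  define p where "p = (rcis (sqrt r) (\<theta> / 2) + \<i> * s)\<^sup>2"
  assume "f ((rcis (sqrt r) (\<theta> / 2) + \<i> * s)\<^sup>2) = 0"
  then have p: "p \<in> divisor \<rho>"
    using assms(5) by (simp add: p_def divisor_def eq_0_iff)
  obtain i where i: "i \<in> UNIV \<times> {-1, 0, 1}" "r / (4 * pi) * \<bar>\<theta> - critical_angle s (p, i)\<bar> \<le> norm (p - p)"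
    using norm_shifted_square_diff_ge[OF assms(1,2), of p] unfolding p_def by blast
  moreover have "r / (4 * pi) > 0"
    using \<open>r > 0\<close> by simp
  ultimately have "\<theta> = critical_angle s (p, i)"
    using mult_le_cancel_left_pos[of "r / (4 * pi)" "\<bar>\<theta> - critical_angle s (p, i)\<bar>" 0] by simp
  moreover have "(p, i) \<in> critical_index \<rho> f"
    using p i by (auto simp: critical_index_eq)
  ultimately show False
    using assms(4) by blast
qed

text \<open>Zeros and poles of modulus above \<rho> are at distance at least d from p. For each of
  the others one of its six critical angles controls the distance; the sum over all six stands in
  for the unknown one.\<close>

lemma sum_inverse_dist_shifted_square_le:
  assumes \<theta>: "\<bar>\<theta>\<bar> \<le> pi" and s: "2 * \<bar>s\<bar> \<le> sqrt r" and "r > 0" and "d > 0"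
    and crit: "\<theta> \<notin> critical_angle s ` critical_index \<rho> f"
  defines "p \<equiv> (rcis (sqrt r) (\<theta> / 2) + \<i> * s)\<^sup>2"
  assumes p: "norm p + d \<le> \<rho>"
  shows "(\<Sum>a\<in>divisor R. \<bar>zorder f a\<bar> / norm (p - a))
    \<le> zero_pole_count R f / d + 4 * pi / r * critical_sum s \<rho> f \<theta>"
proof -
  let ?J = "(UNIV :: bool set) \<times> {-1, 0, 1 :: int}"
  let ?t = "\<lambda>a i. \<bar>zorder f a\<bar> / \<bar>\<theta> - critical_angle s (a, i)\<bar>"
  have fJ: "finite ?J"
    by auto
  have "(\<Sum>a\<in>divisor R. \<bar>zorder f a\<bar> / norm (p - a))
      \<le> (\<Sum>a\<in>divisor R. \<bar>zorder f a\<bar> / d + (if a \<in> divisor \<rho> then 4 * pi / r * (\<Sum>i\<in>?J. ?t a i) else 0))"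
  proof (rule sum_mono)
    fix a assume a: "a \<in> divisor R"
    show "\<bar>zorder f a\<bar> / norm (p - a)
        \<le> \<bar>zorder f a\<bar> / d + (if a \<in> divisor \<rho> then 4 * pi / r * (\<Sum>i\<in>?J. ?t a i) else 0)"
    proof (cases "a \<in> divisor \<rho>")
      case True
      obtain i where i: "i \<in> ?J" "r / (4 * pi) * \<bar>\<theta> - critical_angle s (a, i)\<bar> \<le> norm (p - a)"
        using norm_shifted_square_diff_ge[OF \<theta> s, of a] unfolding p_def by blast
      have "(a, i) \<in> critical_index \<rho> f"
        using True i by (auto simp: critical_index_eq)
      then have "\<theta> \<noteq> critical_angle s (a, i)"
        using crit by blast
      then have pos: "r / (4 * pi) * \<bar>\<theta> - critical_angle s (a, i)\<bar> > 0"
        using \<open>r > 0\<close> by simp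
      have "\<bar>zorder f a\<bar> / norm (p - a) \<le> \<bar>zorder f a\<bar> / (r / (4 * pi) * \<bar>\<theta> - critical_angle s (a, i)\<bar>)"
        by (intro divide_left_mono i(2) mult_pos_pos less_le_trans[OF pos i(2)] pos) auto
      also have "\<dots> = 4 * pi / r * ?t a i"
        by simp
      also have "\<dots> \<le> 4 * pi / r * (\<Sum>i\<in>?J. ?t a i)"
        using \<open>r > 0\<close> by (intro mult_left_mono member_le_sum[OF i(1)] fJ) auto
      finally show ?thesis
        using True \<open>d > 0\<close> by (simp add: add_increasing)
    next
      case False
      then have "norm a > \<rho>"
        using a by (auto simp: divisor_def)
      then have "norm (p - a) \<ge> d"
        using p norm_triangle_ineq2[of a p] by (simp add: norm_minus_commute)
      then have "\<bar>zorder f a\<bar> / norm (p - a) \<le> \<bar>zorder f a\<bar> / d"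
        using \<open>d > 0\<close> by (intro divide_left_mono mult_pos_pos) auto
      then show ?thesis
        using False by simp
    qed
  qed
  also have "\<dots> = zero_pole_count R f / d
      + (\<Sum>a\<in>divisor R. if a \<in> divisor \<rho> then 4 * pi / r * (\<Sum>i\<in>?J. ?t a i) else 0)"
    by (simp add: sum.distrib zero_pole_count_eq sum_divide_distrib)
  also have "(\<Sum>a\<in>divisor R. if a \<in> divisor \<rho> then 4 * pi / r * (\<Sum>i\<in>?J. ?t a i) else 0)
      = (\<Sum>a\<in>divisor R \<inter> divisor \<rho>. 4 * pi / r * (\<Sum>i\<in>?J. ?t a i))"
    by (rule sum.inter_restrict[OF finite_divisor, symmetric])
  also have "\<dots> \<le> (\<Sum>a\<in>divisor \<rho>. 4 * pi / r * (\<Sum>i\<in>?J. ?t a i))"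
    using \<open>r > 0\<close> by (intro sum_mono2 finite_divisor mult_nonneg_nonneg sum_nonneg) auto
  also have "\<dots> = 4 * pi / r * (\<Sum>a\<in>divisor \<rho>. \<Sum>i\<in>?J. ?t a i)"
    by (simp only: sum_distrib_left)
  also have "(\<Sum>a\<in>divisor \<rho>. \<Sum>i\<in>?J. ?t a i) = critical_sum s \<rho> f \<theta>"
    unfolding critical_sum_def critical_index_eq sum.cartesian_product by (intro sum.cong) auto
  finally show ?thesis
    by simp
qed

text \<open>The two points have moduli at most (1 + d) r and distance at most 3 S sqrt r, while 1 +
  2 d = g leaves a gap of d r to the circle of radius \<gamma> r and to the points of modulus above
  \<rho>. In the counting term, 3 comes from the reflected factors and twice 3 from the distant
  zeros and poles of the two sums.\<close>

lemma ln_norm_shifted_square_le: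
  assumes \<theta>: "\<bar>\<theta>\<bar> \<le> pi" and g: "g > 1" and \<gamma>: "\<gamma> \<ge> g" and s: "\<bar>s\<bar> \<le> S"
  defines "d \<equiv> (g - 1) / 2"
  assumes r: "r > 0" "2 * S \<le> sqrt r" "3 * S \<le> d * sqrt r"
    and \<rho>: "g * r \<le> \<rho>"
    and crit: "\<And>u. u \<in> {0, s} \<Longrightarrow> \<theta> \<notin> critical_angle u ` critical_index \<rho> f"
    and W: "\<And>u. u \<in> {0, s} \<Longrightarrow> critical_sum u \<rho> f \<theta> \<le> W"
  defines "w \<equiv> (rcis (sqrt r) (\<theta> / 2) + \<i> * s)\<^sup>2"
  shows "f (rcis r \<theta>) \<noteq> 0 \<and> f w \<noteq> 0 \<and>
    ln (norm (f w)) - ln (norm (f (rcis r \<theta>))) \<le>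
      6 * \<gamma> * S / d\<^sup>2 * (proximity (\<gamma> * r) f + proximity (\<gamma> * r) (\<lambda>z. 1 / f z)) / sqrt r
      + 9 * S / d * zero_pole_count (\<gamma> * r) f / sqrt r
      + 24 * pi * S * W / sqrt r"
proof -
  define z where "z = rcis (sqrt r) (\<theta> / 2)"
  \<comment> \<open>Written with the shift 0, so that the lemmas on shifted squares cover v as well
    as w.\<close>
  define v where "v = (z + \<i> * of_real 0)\<^sup>2"
  have v: "v = rcis r \<theta>"
    using r unfolding v_def z_def by (simp add: power2_eq_square rcis_mult)
  have S: "S \<ge> 0"
    using s by linarith
  have d: "d > 0" "1 + 2 * d = g"
    using g by (auto simp: d_def field_simps)
  define q where "q = sqrt r"
  have q: "q > 0" "r = q\<^sup>2" "2 * S \<le> q" "3 * S \<le> d * q"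
    using r by (auto simp: q_def)
  have nz: "norm z = q"
    using q(1) by (simp add: z_def q_def)
  have dist: "norm (w - v) \<le> 3 * S * q"
  proof -
    have "w - v = 2 * z * (\<i> * of_real s) - of_real (s\<^sup>2)"
      unfolding w_def v_def z_def by (simp add: power2_eq_square algebra_simps)
    then have "norm (w - v) \<le> norm (2 * z * (\<i> * of_real s)) + norm (complex_of_real (s\<^sup>2))"
      by (simp only: norm_triangle_ineq4)
    also have "\<dots> = 2 * q * \<bar>s\<bar> + \<bar>s\<bar> * \<bar>s\<bar>"
      by (simp only: norm_mult norm_of_real nz) (simp add: power2_eq_square)
    also have "\<dots> \<le> 2 * q * S + S * q"
      using q S s by (intro add_mono mult_mono) auto
    finally show ?thesis
      by (simp add: algebra_simps)
  qed
  have Sq: "3 * S * q \<le> d * r"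
    using mult_right_mono[OF q(4), of q] q by (simp add: power2_eq_square)
  \<comment> \<open>Midway between r and g r: it contains both points and still leaves the distance
    d r.\<close>
  define \<rho>' where "\<rho>' = r + d * r"
  have \<rho>': "\<rho>' + d * r = g * r"
    unfolding \<rho>'_def d(2)[symmetric] by (simp add: algebra_simps)
  have nv: "norm v \<le> \<rho>'"
    using d r by (simp add: v \<rho>'_def)
  have nw: "norm w \<le> \<rho>'"
    using norm_triangle_sub[of w v] dist Sq r by (simp add: v \<rho>'_def)
  have gR: "g * r \<le> \<gamma> * r"
    using \<gamma> r by simp
  have Rd: "\<gamma> * r - \<rho>' \<ge> d * r"
    using gR \<rho>' by linarith
  have dr: "d * r > 0"
    using d r by simp
  have s2: "2 * \<bar>0\<bar> \<le> sqrt r" "2 * \<bar>s\<bar> \<le> sqrt r"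
    using s r by auto
  have fv: "f v \<noteq> 0"
    using shifted_square_not_divisor[OF \<theta> s2(1) r(1) crit] nv \<rho>' \<rho> dr
    unfolding v_def z_def by simp
  have fw: "f w \<noteq> 0"
    using shifted_square_not_divisor[OF \<theta> s2(2) r(1) crit] nw \<rho>' \<rho> dr
    unfolding w_def by simp
  let ?n = "real (zero_pole_count (\<gamma> * r) f)"
  let ?D = "norm (w - v)"
  let ?P = "proximity (\<gamma> * r) f + proximity (\<gamma> * r) (\<lambda>z. 1 / f z)"
  have sum: "(\<Sum>a\<in>divisor (\<gamma> * r). \<bar>zorder f a\<bar> / norm (p - a)) \<le> ?n / (d * r) + 4 * pi / r * W"
    if "p = (z + \<i> * of_real u)\<^sup>2" "u \<in> {0, s}" "norm p \<le> \<rho>'" for p u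
  proof -
    have "(\<Sum>a\<in>divisor (\<gamma> * r). \<bar>zorder f a\<bar> / norm (p - a)) \<le> ?n / (d * r) + 4 * pi / r * critical_sum u \<rho> f \<theta>"
      using sum_inverse_dist_shifted_square_le[OF \<theta> _ r(1) dr crit[OF that(2)], of "\<gamma> * r"] that s2 \<rho>' \<rho>
      unfolding z_def by auto
    also have "\<dots> \<le> ?n / (d * r) + 4 * pi / r * W"
      using W[OF that(2)] r by (intro add_left_mono mult_left_mono) auto
    finally show ?thesis .
  qed
  have P: "?P \<ge> 0"
    by (intro add_nonneg_nonneg proximity_nonneg)
  have W0: "W \<ge> 0"
    using W[of 0] by (rule order.trans[rotated]) (auto simp: critical_sum_def intro!: sum_nonneg)
  have "ln (norm (f w)) - ln (norm (f v)) \<le>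
      2 * (\<gamma> * r) * ?D / (\<gamma> * r - \<rho>')\<^sup>2 * ?P + ?D / (\<gamma> * r - \<rho>') * ?n
      + (\<Sum>a\<in>divisor (\<gamma> * r). \<bar>zorder f a\<bar> * (?D / norm (v - a) + ?D / norm (w - a)))"
    by (rule ln_norm_diff_le[OF nv fv nw fw]) (use Rd dr in linarith)
  also have "(\<Sum>a\<in>divisor (\<gamma> * r). \<bar>zorder f a\<bar> * (?D / norm (v - a) + ?D / norm (w - a)))
      = ?D * ((\<Sum>a\<in>divisor (\<gamma> * r). \<bar>zorder f a\<bar> / norm (v - a)) + (\<Sum>a\<in>divisor (\<gamma> * r). \<bar>zorder f a\<bar> / norm (w - a)))"
    by (simp add: sum_distrib_left sum.distrib distrib_left mult_ac)
  also have "\<dots> \<le> (3 * S * q) * ((?n / (d * r) + 4 * pi / r * W) + (?n / (d * r) + 4 * pi / r * W))"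
  proof (intro mult_mono dist add_mono sum)
    show "v = (z + \<i> * of_real 0)\<^sup>2" "w = (z + \<i> * of_real s)\<^sup>2"
      by (auto simp: v_def w_def z_def)
  qed (use nv nw S q in \<open>auto intro!: add_nonneg_nonneg sum_nonneg\<close>)
  also have "2 * (\<gamma> * r) * ?D / (\<gamma> * r - \<rho>')\<^sup>2 * ?P \<le> 2 * (\<gamma> * r) * (3 * S * q) / (d * r)\<^sup>2 * ?P"
    using dist Rd dr P \<gamma> g r S q d(1) by (intro mult_right_mono frac_le mult_left_mono power_mono mult_nonneg_nonneg) auto
  also have "?D / (\<gamma> * r - \<rho>') * ?n \<le> (3 * S * q) / (d * r) * ?n"
    using dist Rd dr S q d(1) by (intro mult_right_mono frac_le mult_nonneg_nonneg) auto
  also have "2 * (\<gamma> * r) * (3 * S * q) / (d * r)\<^sup>2 * ?P = 6 * \<gamma> * S / d\<^sup>2 * ?P / q"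
    using q d by (simp add: field_simps power2_eq_square)
  also have "(3 * S * q) / (d * r) * ?n = 3 * S / d * ?n / q"
    using q d by (simp add: field_simps power2_eq_square)
  also have "(3 * S * q) * ((?n / (d * r) + 4 * pi / r * W) + (?n / (d * r) + 4 * pi / r * W))
      = 6 * S / d * ?n / q + 24 * pi * S * W / q"
    using q d by (simp add: field_simps power2_eq_square)
  finally have "ln (norm (f w)) - ln (norm (f v)) \<le> 6 * \<gamma> * S / d\<^sup>2 * ?P / q + 3 * S / d * ?n / q + (6 * S / d * ?n / q + 24 * pi * S * W / q)"
    by simp
  moreover have "9 * S / d * ?n / q = 3 * S / d * ?n / q + 6 * S / d * ?n / q"
    using q d by (simp add: field_simps)
  ultimately show ?thesis
    using fv fw unfolding v q_def by simp
qed

end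

section \<open>Absorbing the terms of lower order\<close>

text \<open>The bound is uniform in n, as n will depend on r. For n <= 1 the right side is 1,
  because \<open>ln_plus n = 0\<close>, and the left side tends to 0 or below. For n >= 2 one has ln
  (1 + C n y) <= ln n + ln (1 + C y) and 1 <= 2 ln n, so a factor ln n can be taken out; q <
  \<gamma> absorbs the rest. The coefficient on the right does not involve c, which will depend on
  f.\<close>

lemma eventually_count_terms_le:
  fixes K2 K3 C c q \<gamma> :: real
  assumes "K2 \<ge> 0" "K3 \<ge> 0" "C > 0" "0 < q" "q < \<gamma>"
  shows "\<forall>\<^sub>F r in at_top. \<forall>n::nat.
     c / sqrt r + K2 * n / sqrt r + K3 * (n * ln r powr q) * ln (1 + C * (n * ln r powr q)) / sqrt r
       \<le> 1 + (2 * K2 + K3) * (n / sqrt r * ln r powr \<gamma> * ln_plus n)"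
proof -
  have l1: "((\<lambda>r. 1 / sqrt r) \<longlongrightarrow> 0) at_top"
    by real_asymp
  have l2: "((\<lambda>r. ln r powr q * ln (1 + C * ln r powr q) / sqrt r) \<longlongrightarrow> 0) at_top"
    using assms by real_asymp
  have "((\<lambda>r. (\<bar>c\<bar> + K2) * (1 / sqrt r) + K3 * (ln r powr q * ln (1 + C * ln r powr q) / sqrt r))
      \<longlongrightarrow> (\<bar>c\<bar> + K2) * 0 + K3 * 0) at_top"
    by (intro tendsto_intros l1 l2)
  then have e1: "\<forall>\<^sub>F r in at_top. (\<bar>c\<bar> + K2) * (1 / sqrt r) + K3 * (ln r powr q * ln (1 + C * ln r powr q) / sqrt r) < 1"
    by (rule order_tendstoD) simp
  have e2: "\<forall>\<^sub>F r in at_top. ln r powr q * (1 + 2 * ln (1 + C * ln r powr q)) \<le> ln r powr \<gamma>"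
    using assms by real_asymp
  have e3: "\<forall>\<^sub>F r :: real in at_top. r > exp 1"
    by (rule eventually_gt_at_top)
  show ?thesis
    using e1 e2 e3
  proof eventually_elim
    case (elim r)
    define x where "x = ln r"
    have "r > 0"
      using elim(3) exp_gt_zero[of "1 :: real"] by linarith
    have "x > 1"
      using elim(3) ln_less_cancel_iff[of "exp 1" r] \<open>r > 0\<close> by (simp add: x_def)
    define y where "y = x powr q"
    define Y where "Y = x powr \<gamma>"
    have y: "y \<ge> 0" "Y \<ge> 1"
      using \<open>x > 1\<close> assms by (auto simp: y_def Y_def ge_one_powr_ge_zero)
    define h where "h = sqrt r"
    have h: "h > 0"
      using \<open>r > 0\<close> by (simp add: h_def)
    have "((\<bar>c\<bar> + K2) + K3 * (y * ln (1 + C * y))) / h < 1"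
      using elim(1) unfolding x_def[symmetric] y_def[symmetric] h_def[symmetric] by (simp add: add_divide_distrib)
    then have E1: "(\<bar>c\<bar> + K2) + K3 * (y * ln (1 + C * y)) < h"
      using h by (simp only: divide_less_eq) simp
    have E2: "y * (1 + 2 * ln (1 + C * y)) \<le> Y"
      using elim(2) unfolding x_def[symmetric] y_def[symmetric] Y_def[symmetric] .
    have pos: "1 + C * y > 0"
      using y assms by (intro add_pos_nonneg) auto
    have lnC: "ln (1 + C * y) \<ge> 0"
      using y assms by (intro ln_ge_zero) simp
    have "0 \<le> K3 * (y * ln (1 + C * y))"
      using lnC y assms by (intro mult_nonneg_nonneg) auto
    then have ch: "c \<le> h"
      using E1 \<open>K2 \<ge> 0\<close> by linarith
    have "c + K2 * n + K3 * (n * y) * ln (1 + C * (n * y)) \<le> h + (2 * K2 + K3) * (n * Y * ln_plus n)" for n :: nat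
    proof (cases "n \<ge> 2")
      case True
      then have n: "real n \<ge> 2"
        by simp
      have "ln_plus n = ln n"
        using n by (simp add: ln_plus_def max_def)
      have "1 / 2 \<le> ln (2 :: real)"
        using ln2_ge_two_thirds by linarith
      also have "ln 2 \<le> ln (real n)"
        using n by simp
      finally have ln2: "1 \<le> 2 * ln (real n)"
        by simp
      have "K2 * n \<le> 2 * K2 * (n * Y * ln n)"
      proof -
        have "K2 * n * 1 \<le> K2 * n * (Y * (2 * ln n))"
          using mult_mono[OF y(2) ln2] y assms by (intro mult_left_mono) auto
        then show ?thesis
          by (simp add: mult_ac)
      qed
      moreover have "K3 * (n * y) * ln (1 + C * (n * y)) \<le> K3 * (n * Y * ln n)"
      proof -
        have "1 + C * (n * y) \<le> n * (1 + C * y)"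
          using n by (simp add: distrib_left mult_ac)
        then have "ln (1 + C * (n * y)) \<le> ln (n * (1 + C * y))"
          using y assms n by (subst ln_le_cancel_iff) (auto intro!: add_pos_nonneg mult_pos_pos)
        also have "\<dots> = ln n + ln (1 + C * y)"
          using pos n by (subst ln_mult) auto
        also have "\<dots> \<le> ln n + 2 * ln n * ln (1 + C * y)"
          using mult_right_mono[OF ln2 lnC] by simp
        finally have "ln (1 + C * (n * y)) \<le> (1 + 2 * ln (1 + C * y)) * ln n"
          by (simp add: algebra_simps)
        then have "y * ln (1 + C * (n * y)) \<le> y * ((1 + 2 * ln (1 + C * y)) * ln n)"
          by (rule mult_left_mono) (rule y(1))
        also have "\<dots> = (y * (1 + 2 * ln (1 + C * y))) * ln n"
          by simp
        also have "\<dots> \<le> Y * ln n"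
          by (rule mult_right_mono[OF E2]) (use ln2 in linarith)
        finally have "K3 * n * (y * ln (1 + C * (n * y))) \<le> K3 * n * (Y * ln n)"
          using assms by (intro mult_left_mono) auto
        then show ?thesis
          by (simp add: mult_ac)
      qed
      ultimately show ?thesis
        unfolding \<open>ln_plus n = ln n\<close> distrib_right using ch by linarith
    next
      case False
      then consider "n = 0" | "n = 1"
        by linarith
      then have "c + K2 * n + K3 * (n * y) * ln (1 + C * (n * y)) \<le> h"
      proof cases
        case 1
        then show ?thesis
          using ch by simp
      next
        case 2
        then show ?thesis
          using E1 by (simp add: mult_ac)
      qed
      moreover have "0 \<le> (2 * K2 + K3) * (n * Y * ln_plus n)"
        using assms y ln_plus_nonneg by (intro mult_nonneg_nonneg) auto
      ultimately show ?thesis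
        by linarith
    qed
    then have le: "(c + K2 * n + K3 * (n * y) * ln (1 + C * (n * y))) / h \<le> (h + (2 * K2 + K3) * (n * Y * ln_plus n)) / h" for n :: nat
      using h by (intro divide_right_mono) auto
    show ?case
      unfolding x_def[symmetric] y_def[symmetric] Y_def[symmetric] h_def[symmetric]
    proof
      fix n :: nat
      have "c / h + K2 * n / h + K3 * (n * y) * ln (1 + C * (n * y)) / h
          = (c + K2 * n + K3 * (n * y) * ln (1 + C * (n * y))) / h"
        by (simp only: add_divide_distrib)
      also note le
      also have "(h + (2 * K2 + K3) * (n * Y * ln_plus n)) / h = h / h + (2 * K2 + K3) * (n / h * Y * ln_plus n)"
        by (simp only: add_divide_distrib times_divide_eq_right times_divide_eq_left)
      also have "h / h = 1"
        using h by simp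
      finally show "c / h + K2 * n / h + K3 * (n * y) * ln (1 + C * (n * y)) / h
          \<le> 1 + (2 * K2 + K3) * (n / h * Y * ln_plus n)" .
    qed
  qed
qed

definition growth_exponent :: "real \<Rightarrow> (complex \<Rightarrow> complex) \<Rightarrow> real \<Rightarrow> real" where
  "growth_exponent \<gamma> f r = nevanlinna_T (\<gamma> * r) f / sqrt r
     + real (zero_pole_count (\<gamma> * r) f) / sqrt r * (ln r powr \<gamma>) * ln_plus (real (zero_pole_count (\<gamma> * r) f))"

context nonzero_meromorphic
begin

text \<open>The critical angles lie in [-4 pi, 4 pi], whence 5 pi = 4 pi + pi, and each zero or pole
  carries six indices.\<close>

lemma AE_critical_sum_le:
  assumes "q > 1"
  shows "AE \<theta> in lborel. \<bar>\<theta>\<bar> \<le> pi \<longrightarrow> (\<forall>\<^sub>F k in sequentially. \<theta> \<notin> critical_angle u ` critical_index (R k) f \<and>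
    critical_sum u (R k) f \<theta> \<le> 4 * (6 * zero_pole_count (R k) f * real k powr q)
      * ln (1 + 5 * pi * (6 * zero_pole_count (R k) f * real k powr q)))"
proof -
  have "AE \<theta> in lborel. \<bar>\<theta>\<bar> \<le> pi \<longrightarrow> (\<forall>\<^sub>F k in sequentially. \<theta> \<notin> critical_angle u ` critical_index (R k) f \<and>
     (\<Sum>i\<in>critical_index (R k) f. \<bar>real_of_int (zorder f (fst i))\<bar> / \<bar>\<theta> - critical_angle u i\<bar>)
       \<le> 4 * ((\<Sum>i\<in>critical_index (R k) f. \<bar>real_of_int (zorder f (fst i))\<bar>) * real k powr q)
         * ln (1 + (4 * pi + pi) * ((\<Sum>i\<in>critical_index (R k) f. \<bar>real_of_int (zorder f (fst i))\<bar>) * real k powr q)))"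
  proof (rule AE_sum_inverse_dist_le[OF finite_critical_index _ _ assms])
    fix k i assume "i \<in> critical_index (R k) f"
    then have "zorder f (fst i) \<noteq> 0" and "snd (snd i) \<in> {-1, 0, 1}"
      by (auto simp: critical_index_def)
    from this(1) show "1 \<le> \<bar>real_of_int (zorder f (fst i))\<bar>"
      by linarith
    show "\<bar>critical_angle u i\<bar> \<le> 4 * pi"
      using abs_critical_angle_le[of "snd (snd i)" u "fst i" "fst (snd i)"] \<open>snd (snd i) \<in> _\<close> by simp
  qed
  moreover have "(\<Sum>i\<in>critical_index (R k) f. \<bar>real_of_int (zorder f (fst i))\<bar> / \<bar>\<theta> - critical_angle u i\<bar>)
      = critical_sum u (R k) f \<theta>" for k \<theta>
    by (simp add: critical_sum_def)
  ultimately show ?thesis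
    unfolding sum_critical_index by simp
qed

lemma growth_exponent_nonneg:
  assumes "\<gamma> \<ge> 1" "r \<ge> 1"
  shows "growth_exponent \<gamma> f r \<ge> 0"
proof -
  have "1 * 1 \<le> \<gamma> * r"
    using assms by (intro mult_mono) auto
  then show ?thesis
    unfolding growth_exponent_def using assms
    by (intro add_nonneg_nonneg divide_nonneg_nonneg mult_nonneg_nonneg nevanlinna_T_nonneg ln_plus_nonneg) auto
qed

end

text \<open>The points of modulus at most \<open>\<gamma> g\<^sup>k\<close> with \<open>g\<^sup>2 = \<gamma>\<close> contain those of modulus at most \<open>g r\<close> and are
  among those of modulus at most \<open>\<gamma> r\<close> whenever \<open>g\<^sup>k \<le> r \<le> g\<^sup>k\<^sup>+\<^sup>1\<close>; so countably many exceptional sets suffice.\<close>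

lemma AE_shifted_square_ratio_le:
  assumes "\<gamma> > 1" "finite S"
  obtains B where "B \<ge> 0" "\<And>f. nonzero_meromorphic f \<Longrightarrow>
    AE \<theta> in lborel. \<bar>\<theta>\<bar> \<le> pi \<longrightarrow> (\<forall>\<^sub>F r in at_top. f (rcis r \<theta>) \<noteq> 0 \<and>
      (\<forall>s\<in>S. norm (f ((rcis (sqrt r) (\<theta> / 2) + \<i> * of_real s)\<^sup>2))
          \<le> exp (1 + B * growth_exponent \<gamma> f r) * norm (f (rcis r \<theta>))))"
proof -
  define g where "g = sqrt \<gamma>"
  have g: "g > 1" "g * g = \<gamma>"
    using assms by (auto simp: g_def)
  have \<gamma>g: "\<gamma> \<ge> g"
    using g by (metis less_imp_le mult_le_cancel_right1 order.trans zero_le_one not_one_le_zero linorder_not_less)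
  define l where "l = ln g"
  have l: "l > 0"
    using g by (simp add: l_def)
  \<comment> \<open>Above 1 for the Borel-Cantelli lemma, below \<gamma> so that the logarithms left
    over can be absorbed.\<close>
  define q where "q = (1 + \<gamma>) / 2"
  have q: "q > 1" "q < \<gamma>" "q > 0"
    using assms by (auto simp: q_def)
  define S0 where "S0 = (\<Sum>s\<in>S. \<bar>s\<bar>)"
  have S0: "\<bar>s\<bar> \<le> S0" if "s \<in> insert 0 S" for s
    using that member_le_sum[of s S abs] assms(2) by (auto simp: S0_def intro: sum_nonneg)
  then have S0_nonneg: "S0 \<ge> 0"
    by (metis abs_zero insertI1)
  define d where "d = (g - 1) / 2"
  have d: "d > 0"
    using g by (simp add: d_def)
  \<comment> \<open>Chosen so that 6 n k^q <= L n (ln r)^q whenever k <= ln r / l.\<close>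
  define L where "L = 6 * (1 / l) powr q"
  have L: "L > 0"
    using l by (simp add: L_def)
  define K1 where "K1 = 6 * \<gamma> * S0 / d\<^sup>2"
  define K2 where "K2 = 9 * S0 / d"
  define K3 where "K3 = 24 * pi * S0 * (4 * L)"
  have K: "K1 \<ge> 0" "K2 \<ge> 0" "K3 \<ge> 0"
    using assms S0_nonneg d L by (auto simp: K1_def K2_def K3_def)
  define C where "C = 5 * pi * L"
  have C: "C > 0"
    using L by (simp add: C_def)
  \<comment> \<open>The coefficient 2 K1 belongs to the characteristic, through the bound 2 T + c
    for the proximity functions, and 2 K2 + K3 to the counting term. All constants are fixed before
    f.\<close>
  define B where "B = 2 * K1 + (2 * K2 + K3)"
  have "B \<ge> 0"
    using K by (simp add: B_def)
  moreover have "AE \<theta> in lborel. \<bar>\<theta>\<bar> \<le> pi \<longrightarrow> (\<forall>\<^sub>F r in at_top. f (rcis r \<theta>) \<noteq> 0 \<and>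
      (\<forall>s\<in>S. norm (f ((rcis (sqrt r) (\<theta> / 2) + \<i> * of_real s)\<^sup>2))
          \<le> exp (1 + B * growth_exponent \<gamma> f r) * norm (f (rcis r \<theta>))))"
    if f: "nonzero_meromorphic f" for f
  proof -
    interpret nonzero_meromorphic f
      by (rule f)
    obtain c where c: "\<And>R. R \<ge> 1 \<Longrightarrow> proximity R f + proximity R (\<lambda>z. 1 / f z) \<le> 2 * nevanlinna_T R f + c"
      by (rule proximity_sum_le) blast
    define good where "good = (\<lambda>\<theta> u k. \<theta> \<notin> critical_angle u ` critical_index (\<gamma> * g ^ k) f \<and>
      critical_sum u (\<gamma> * g ^ k) f \<theta> \<le> 4 * (6 * zero_pole_count (\<gamma> * g ^ k) f * real k powr q)
        * ln (1 + 5 * pi * (6 * zero_pole_count (\<gamma> * g ^ k) f * real k powr q)))"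
    \<comment> \<open>The shift 0 is included for the point \<open>rcis r \<theta>\<close>
      itself.\<close>
    have "AE \<theta> in lborel. \<forall>u\<in>insert 0 S. \<bar>\<theta>\<bar> \<le> pi \<longrightarrow> (\<forall>\<^sub>F k in sequentially. good \<theta> u k)"
      unfolding good_def using assms(2) by (intro AE_finite_allI AE_critical_sum_le[OF q(1)]) auto
    then show ?thesis
    proof eventually_elim
      case (elim \<theta>)
      show ?case
      proof
        assume \<theta>: "\<bar>\<theta>\<bar> \<le> pi"
        with elim have "\<forall>\<^sub>F k in sequentially. \<forall>u\<in>insert 0 S. good \<theta> u k"
          using assms(2) by (intro eventually_ball_finite) auto
        \<comment> \<open>The index k with g^k <= r <= g^(k+1); it tends to infinity with r, which
          turns a property of all large k into one of all large r.\<close>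
        moreover define kk where "kk = (\<lambda>r. nat \<lfloor>ln r / l\<rfloor>)"
        have "filterlim kk sequentially at_top"
        proof -
          have "filterlim (\<lambda>r. ln r / l) at_top at_top"
            using l by real_asymp
          then show ?thesis
            unfolding kk_def
            by (intro filterlim_compose[OF filterlim_nat_sequentially] filterlim_compose[OF filterlim_floor_sequentially])
        qed
        ultimately have ev1: "\<forall>\<^sub>F r in at_top. \<forall>u\<in>insert 0 S. good \<theta> u (kk r)"
          by (rule eventually_compose_filterlim)
        have ev2: "\<forall>\<^sub>F r in at_top. \<forall>n::nat.
           K1 * c / sqrt r + K2 * n / sqrt r + K3 * (n * ln r powr q) * ln (1 + C * (n * ln r powr q)) / sqrt r
             \<le> 1 + (2 * K2 + K3) * (n / sqrt r * ln r powr \<gamma> * ln_plus n)"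
          by (rule eventually_count_terms_le) (use K C q in auto)
        have ev3: "\<forall>\<^sub>F r in at_top. 2 * S0 \<le> sqrt r" "\<forall>\<^sub>F r in at_top. 3 * S0 \<le> d * sqrt r"
          using d by real_asymp+
        have ev4: "\<forall>\<^sub>F r :: real in at_top. r > 1"
          by (rule eventually_gt_at_top)
        show "\<forall>\<^sub>F r in at_top. f (rcis r \<theta>) \<noteq> 0 \<and>
          (\<forall>s\<in>S. norm (f ((rcis (sqrt r) (\<theta> / 2) + \<i> * of_real s)\<^sup>2))
          \<le> exp (1 + B * growth_exponent \<gamma> f r) * norm (f (rcis r \<theta>)))"
          using ev1 ev2 ev3 ev4
        proof eventually_elim
          case (elim r)
          have r: "r > 0" "r > 1"
            using elim by auto
          define n where "n = zero_pole_count (\<gamma> * r) f"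
          define T where "T = nevanlinna_T (\<gamma> * r) f"
          define x where "x = ln r"
          have x: "x > 0"
            using r by (simp add: x_def)
          define k where "k = kk r"
          have kx: "real k \<le> x / l" "x / l < real k + 1"
          proof -
            have "x / l \<ge> 0"
              using x l by simp
            then have "real k = of_int \<lfloor>x / l\<rfloor>"
              unfolding k_def kk_def x_def by simp
            then show "real k \<le> x / l" "x / l < real k + 1"
              by linarith+
          qed
          have gk: "g ^ j = exp (real j * l)" for j
            using g by (simp add: l_def exp_of_nat_mult)
          have "real k * l \<le> x"
            using kx(1) l by (simp add: field_simps)
          then have gkr: "g ^ k \<le> r"
            unfolding gk using r by (simp add: x_def ln_ge_iff)
          have "x \<le> real (Suc k) * l"
            using kx(2) l by (simp add: field_simps)
          then have "exp x \<le> exp (real (Suc k) * l)"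
            by (simp only: exp_le_cancel_iff)
          moreover have "exp x = r"
            using r by (simp add: x_def)
          ultimately have rgk: "r \<le> g ^ Suc k"
            unfolding gk by (simp only:)
          define \<rho> where "\<rho> = \<gamma> * g ^ k"
          have \<rho>: "g * r \<le> \<rho>" "\<rho> \<le> \<gamma> * r"
          proof -
            have "g * r \<le> g * g ^ Suc k"
              using rgk g by (intro mult_left_mono) auto
            also have "\<dots> = \<rho>"
              unfolding \<rho>_def g(2)[symmetric] by simp
            finally show "g * r \<le> \<rho>" .
            show "\<rho> \<le> \<gamma> * r"
              using gkr assms by (simp add: \<rho>_def)
          qed
          have cnt: "6 * zero_pole_count \<rho> f * real k powr q \<le> L * (n * x powr q)"
          proof -
            have "real k powr q \<le> (x / l) powr q"
              using kx q by (intro powr_mono2) auto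
            also have "\<dots> = (1 / l) powr q * x powr q"
              using x l by (simp add: powr_mult[symmetric])
            finally have "6 * zero_pole_count \<rho> f * real k powr q \<le> 6 * n * ((1 / l) powr q * x powr q)"
              using zero_pole_count_mono[OF \<rho>(2)] by (intro mult_mono) (auto simp: n_def)
            then show ?thesis
              by (simp add: L_def mult_ac)
          qed
          define W where "W = 4 * (L * (n * x powr q)) * ln (1 + C * (n * x powr q))"
          have crit: "\<theta> \<notin> critical_angle u ` critical_index \<rho> f" "critical_sum u \<rho> f \<theta> \<le> W" if "u \<in> insert 0 S" for u
          proof -
            have G: "good \<theta> u k"
              using elim(1) that unfolding k_def by blast
            then show "\<theta> \<notin> critical_angle u ` critical_index \<rho> f"
              unfolding good_def \<rho>_def by blast
            let ?N = "6 * zero_pole_count \<rho> f * real k powr q"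
            have N: "?N \<ge> 0"
              by simp
            have "critical_sum u \<rho> f \<theta> \<le> 4 * ?N * ln (1 + 5 * pi * ?N)"
              using G unfolding good_def \<rho>_def by blast
            also have "\<dots> \<le> 4 * (L * (n * x powr q)) * ln (1 + 5 * pi * (L * (n * x powr q)))"
            proof (rule mult_mono)
              show "4 * ?N \<le> 4 * (L * (n * x powr q))"
                using cnt by simp
              have "5 * pi * ?N \<le> 5 * pi * (L * (n * x powr q))"
                using cnt by (intro mult_left_mono) auto
              then show "ln (1 + 5 * pi * ?N) \<le> ln (1 + 5 * pi * (L * (n * x powr q)))"
                using N by (subst ln_le_cancel_iff) (auto intro!: add_pos_nonneg mult_nonneg_nonneg less_imp_le[OF L])
              show "0 \<le> ln (1 + 5 * pi * ?N)"
                by (rule ln_ge_zero) simp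
            qed (use L in simp)
            also have "\<dots> = W"
              by (simp add: W_def C_def mult_ac)
            finally show "critical_sum u \<rho> f \<theta> \<le> W" .
          qed
          have "1 * 1 \<le> \<gamma> * r"
            using assms r by (intro mult_mono) auto
          then have gr1: "\<gamma> * r \<ge> 1"
            by simp
          have T: "T \<ge> 0"
            unfolding T_def by (rule nevanlinna_T_nonneg[OF gr1])
          define X where "X = n / sqrt r * ln r powr \<gamma> * ln_plus n"
          have X: "X \<ge> 0"
            using r unfolding X_def by (intro mult_nonneg_nonneg ln_plus_nonneg) auto
          have GE: "growth_exponent \<gamma> f r = T / sqrt r + X"
            by (simp add: growth_exponent_def T_def X_def n_def)
          have main: "f (rcis r \<theta>) \<noteq> 0 \<and> norm (f ((rcis (sqrt r) (\<theta> / 2) + \<i> * of_real s)\<^sup>2))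
            \<le> exp (1 + B * growth_exponent \<gamma> f r) * norm (f (rcis r \<theta>))" if s: "s \<in> insert 0 S" for s
          proof -
            let ?w = "(rcis (sqrt r) (\<theta> / 2) + \<i> * of_real s)\<^sup>2"
            let ?P = "proximity (\<gamma> * r) f + proximity (\<gamma> * r) (\<lambda>z. 1 / f z)"
            have *: "f (rcis r \<theta>) \<noteq> 0 \<and> f ?w \<noteq> 0 \<and>
              ln (norm (f ?w)) - ln (norm (f (rcis r \<theta>))) \<le>
                K1 * ?P / sqrt r + K2 * n / sqrt r + 24 * pi * S0 * W / sqrt r"
              unfolding K1_def K2_def d_def n_def
              by (rule ln_norm_shifted_square_le[OF \<theta> g(1) \<gamma>g S0[OF s] r(1) _ _ \<rho>(1)])
                 (use crit s elim(3,4) in \<open>auto simp: d_def\<close>)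
            have "K1 * ?P / sqrt r \<le> K1 * (2 * T + c) / sqrt r"
              using c[OF gr1] K r by (intro divide_right_mono mult_left_mono) (auto simp: T_def)
            also have "\<dots> = 2 * K1 * (T / sqrt r) + K1 * c / sqrt r"
              by (simp add: distrib_left add_divide_distrib)
            finally have 1: "K1 * ?P / sqrt r \<le> 2 * K1 * (T / sqrt r) + K1 * c / sqrt r" .
            have 2: "24 * pi * S0 * W / sqrt r = K3 * (n * x powr q) * ln (1 + C * (n * x powr q)) / sqrt r"
              by (simp add: W_def K3_def mult_ac)
            have 3: "K1 * c / sqrt r + K2 * n / sqrt r + K3 * (n * x powr q) * ln (1 + C * (n * x powr q)) / sqrt r
               \<le> 1 + (2 * K2 + K3) * X"
              using elim(2) unfolding x_def X_def by blast
            have "2 * K1 * (T / sqrt r) \<le> B * (T / sqrt r)"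
              using K T r by (intro mult_right_mono) (auto simp: B_def)
            moreover have "(2 * K2 + K3) * X \<le> B * X"
              using K X by (intro mult_right_mono) (auto simp: B_def)
            ultimately have "ln (norm (f ?w)) - ln (norm (f (rcis r \<theta>))) \<le> 1 + B * growth_exponent \<gamma> f r"
              unfolding GE distrib_left using * 1 2 3 by linarith
            then have "ln (norm (f ?w)) \<le> 1 + B * growth_exponent \<gamma> f r + ln (norm (f (rcis r \<theta>)))"
              by simp
            then have "exp (ln (norm (f ?w))) \<le> exp (1 + B * growth_exponent \<gamma> f r + ln (norm (f (rcis r \<theta>))))"
              by (simp only: exp_le_cancel_iff)
            then show ?thesis
              using * by (simp add: exp_add)
          qed
          \<comment> \<open>The shift 0 yields the nonvanishing of f at
            \<open>rcis r \<theta>\<close> even when S is empty.\<close>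
          from main[of 0] main show ?case
            by blast
        qed
      qed
    qed
  qed
  ultimately show thesis
    by (rule that)
qed


section \<open>The Wilson operator\<close>

lemma norm_wilson_le:
  assumes "z \<noteq> 0" "norm (f ((z + \<i> / 2)\<^sup>2)) \<le> M" "norm (f ((z - \<i> / 2)\<^sup>2)) \<le> M"
  shows "norm (wilson f (z\<^sup>2)) \<le> M / norm z"
proof -
  have "wilson f (z\<^sup>2) = (f ((z + \<i> / 2)\<^sup>2) - f ((z - \<i> / 2)\<^sup>2)) / (2 * \<i> * z)"
    using assms(1) by (intro wilson_square) auto
  also have "norm \<dots> = norm (f ((z + \<i> / 2)\<^sup>2) - f ((z - \<i> / 2)\<^sup>2)) / (2 * norm z)"
    by (simp add: norm_divide norm_mult)
  also have "\<dots> \<le> (M + M) / (2 * norm z)"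
    using norm_triangle_ineq4[of "f ((z + \<i> / 2)\<^sup>2)" "f ((z - \<i> / 2)\<^sup>2)"] assms(2,3)
    by (intro divide_right_mono) auto
  finally show ?thesis
    by simp
qed

text \<open>Each application moves the square root by i/2 up or down, so k of them only involve the
  points (z + i j / 2)^2 with |j| <= k. Of the k divisions only the outermost one is kept; the inner
  ones divide by moduli that |z| >= k + 1 keeps at least 1.\<close>

lemma norm_wilson_funpow_le:
  assumes "k \<ge> 1" "norm z \<ge> real k + 1"
    and "\<And>j::int. \<bar>j\<bar> \<le> int k \<Longrightarrow> norm (f ((z + \<i> * of_real (j / 2))\<^sup>2)) \<le> M"
  shows "norm ((wilson ^^ k) f (z\<^sup>2)) \<le> M / norm z"
proof -
  have step: "norm ((wilson ^^ Suc k) f (z\<^sup>2)) \<le> M / norm z"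
    if IH: "\<And>z. norm z \<ge> real k + 1 \<Longrightarrow> (\<And>j::int. \<bar>j\<bar> \<le> int k \<Longrightarrow> norm (f ((z + \<i> * of_real (j / 2))\<^sup>2)) \<le> M)
        \<Longrightarrow> norm ((wilson ^^ k) f (z\<^sup>2)) \<le> M"
      and z: "norm z \<ge> real (Suc k) + 1"
      and f: "\<And>j::int. \<bar>j\<bar> \<le> int (Suc k) \<Longrightarrow> norm (f ((z + \<i> * of_real (j / 2))\<^sup>2)) \<le> M" for k z
  proof -
    have "norm ((wilson ^^ k) f ((z + \<i> / 2)\<^sup>2)) \<le> M"
    proof (rule IH)
      show "real k + 1 \<le> norm (z + \<i> / 2)"
        using z norm_diff_ineq[of z "\<i> / 2"] by (simp add: norm_divide)
      show "norm (f ((z + \<i> / 2 + \<i> * of_real (j / 2))\<^sup>2)) \<le> M" if "\<bar>j\<bar> \<le> int k" for j :: int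
        using f[of "j + 1"] that by (simp add: add_divide_distrib algebra_simps)
    qed
    moreover have "norm ((wilson ^^ k) f ((z - \<i> / 2)\<^sup>2)) \<le> M"
    proof (rule IH)
      show "real k + 1 \<le> norm (z - \<i> / 2)"
        using z norm_triangle_ineq2[of z "\<i> / 2"] by (simp add: norm_divide)
      show "norm (f ((z - \<i> / 2 + \<i> * of_real (j / 2))\<^sup>2)) \<le> M" if "\<bar>j\<bar> \<le> int k" for j :: int
        using f[of "j - 1"] that by (simp add: diff_divide_distrib algebra_simps)
    qed
    moreover have "z \<noteq> 0"
      using z by auto
    ultimately show ?thesis
      using norm_wilson_le[of z "(wilson ^^ k) f" M] by simp
  qed
  have bound: "norm ((wilson ^^ k) f (z\<^sup>2)) \<le> M"
    if "norm z \<ge> real k + 1" "\<And>j::int. \<bar>j\<bar> \<le> int k \<Longrightarrow> norm (f ((z + \<i> * of_real (j / 2))\<^sup>2)) \<le> M" for k z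
    using that
  proof (induction k arbitrary: z)
    case 0
    then show ?case
      using "0.prems"(2)[of 0] by simp
  next
    case (Suc k)
    have "M \<ge> 0"
      by (rule order.trans[OF norm_ge_zero Suc.prems(2)[of 0]]) simp
    have "norm ((wilson ^^ Suc k) f (z\<^sup>2)) \<le> M / norm z"
      using Suc by (intro step) auto
    also have "M / norm z \<le> M / 1"
      using Suc.prems(1) \<open>M \<ge> 0\<close> by (intro divide_left_mono) auto
    finally show ?case
      by simp
  qed
  show ?thesis
    using assms step[OF bound, of "k - 1" z] by (cases k) auto
qed

section \<open>The growth exponent for functions of finite order\<close>

text \<open>The exponent p is positive because the quotient in the upper limit is nonnegative for r
  > 1.\<close>

lemma growth_order_imp_eventually_T_le:
  assumes "growth_order f = ereal \<sigma>" "\<sigma> < p"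
  shows "p > 0" "\<forall>\<^sub>F r in at_top. nevanlinna_T r f \<le> r powr p"
proof -
  have "Limsup at_top (\<lambda>r::real. ereal (ln_plus (nevanlinna_T r f) / ln r)) < ereal p"
    using assms by (simp add: growth_order_def)
  then have "\<forall>\<^sub>F r in at_top. ereal (ln_plus (nevanlinna_T r f) / ln r) < ereal p"
    by (rule Limsup_lessD)
  moreover have "\<forall>\<^sub>F r :: real in at_top. r > 1"
    by (rule eventually_gt_at_top)
  ultimately have ev: "\<forall>\<^sub>F r in at_top. p > 0 \<and> nevanlinna_T r f \<le> r powr p"
  proof eventually_elim
    case (elim r)
    have "ln r > 0"
      using elim(2) by simp
    have lt: "ln_plus (nevanlinna_T r f) / ln r < p"
      using elim(1) by simp
    moreover have "ln_plus (nevanlinna_T r f) / ln r \<ge> 0"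
      using \<open>ln r > 0\<close> ln_plus_nonneg by simp
    ultimately have "p > 0"
      by linarith
    have "ln (max 1 (nevanlinna_T r f)) \<le> p * ln r"
      using lt \<open>ln r > 0\<close> by (simp add: ln_plus_def field_simps)
    then have "exp (ln (max 1 (nevanlinna_T r f))) \<le> exp (p * ln r)"
      by (simp only: exp_le_cancel_iff)
    then show ?case
      using \<open>p > 0\<close> elim(2) by (simp add: powr_def)
  qed
  then show "\<forall>\<^sub>F r in at_top. nevanlinna_T r f \<le> r powr p"
    by eventually_elim auto
  from ev show "p > 0"
    using eventually_happens'[OF _ ev] by auto
qed

text \<open>Half of \<epsilon> goes into T(r, f) <= r^p with p = \<sigma> + \<epsilon> / 2. Jensen's
  formula bounds n(2 r) through T(4 r, f), hence by O(r^p), and the powers of ln r and the constants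
  are absorbed by the other r^(\<epsilon> / 2).\<close>

lemma eventually_growth_exponent_le:
  assumes f: "nonzero_meromorphic f" and ord: "growth_order f = ereal \<sigma>" and "\<epsilon> > 0"
  shows "\<forall>\<^sub>F r in at_top. B * growth_exponent 2 f r \<le> r powr (\<sigma> - 1 / 2 + \<epsilon>)"
proof -
  interpret nonzero_meromorphic f
    by (rule f)
  define p where "p = \<sigma> + \<epsilon> / 2"
  have "\<sigma> < p"
    using \<open>\<epsilon> > 0\<close> by (simp add: p_def)
  note p = growth_order_imp_eventually_T_le[OF ord \<open>\<sigma> < p\<close>]
  obtain c where c: "\<And>R \<gamma>. R \<ge> 1 \<Longrightarrow> \<gamma> > 1 \<Longrightarrow> ln \<gamma> * zero_pole_count R f \<le> 2 * nevanlinna_T (\<gamma> * R) f + c"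
    by (rule proximity_sum_le) blast
  \<comment> \<open>From ln 2 >= 1/2 and T(4 r, f) <= (4 r)^p one gets n(2 r) <= 2 (2 T(4 r, f) +
    |c|) <= A r^p.\<close>
  define A where "A = 2 * (2 * 4 powr p + \<bar>c\<bar>)"
  have "A \<ge> 1"
    using ge_one_powr_ge_zero[of 4 p] p(1) unfolding A_def by simp
  have T2: "\<forall>\<^sub>F r in at_top. nevanlinna_T (2 * r) f \<le> (2 * r) powr p"
    by (rule eventually_compose_filterlim[OF p(2)]) real_asymp
  have T4: "\<forall>\<^sub>F r in at_top. nevanlinna_T (4 * r) f \<le> (4 * r) powr p"
    by (rule eventually_compose_filterlim[OF p(2)]) real_asymp
  have lim: "((\<lambda>r. \<bar>B\<bar> * (2 powr p * (1 / r powr (\<epsilon> / 2)) + A * (ln A * (ln r powr 2 / r powr (\<epsilon> / 2))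
       + p * (ln r powr 2 * ln r / r powr (\<epsilon> / 2)))))
      \<longlongrightarrow> \<bar>B\<bar> * (2 powr p * 0 + A * (ln A * 0 + p * 0))) at_top"
  proof (intro tendsto_intros)
    show "((\<lambda>r. 1 / r powr (\<epsilon> / 2)) \<longlongrightarrow> 0) at_top"
      using \<open>\<epsilon> > 0\<close> by real_asymp
    show "((\<lambda>r. ln r powr 2 / r powr (\<epsilon> / 2)) \<longlongrightarrow> 0) at_top"
      using \<open>\<epsilon> > 0\<close> by real_asymp
    show "((\<lambda>r. ln r powr 2 * ln r / r powr (\<epsilon> / 2)) \<longlongrightarrow> 0) at_top"
      using \<open>\<epsilon> > 0\<close> by real_asymp
  qed
  have small: "\<forall>\<^sub>F r in at_top. \<bar>B\<bar> * (2 powr p * (1 / r powr (\<epsilon> / 2)) + A * (ln A * (ln r powr 2 / r powr (\<epsilon> / 2))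
       + p * (ln r powr 2 * ln r / r powr (\<epsilon> / 2)))) < 1"
    using lim by (rule order_tendstoD) simp
  have "\<forall>\<^sub>F r :: real in at_top. r > 1"
    by (rule eventually_gt_at_top)
  with T2 T4 small show ?thesis
  proof eventually_elim
    case (elim r)
    have r: "r > 1"
      by (rule elim(4))
    define n where "n = real (zero_pole_count (2 * r) f)"
    define x where "x = ln r"
    have x: "x > 0"
      using r by (simp add: x_def)
    have "1 / 2 * n \<le> ln 2 * n"
      using ln2_ge_two_thirds by (intro mult_right_mono) (auto simp: n_def)
    also have "\<dots> \<le> 2 * nevanlinna_T (4 * r) f + c"
      using c[of "2 * r" 2] r by (simp add: n_def)
    also have "\<dots> \<le> 2 * (4 powr p * r powr p) + \<bar>c\<bar> * r powr p"
      using elim(2) r p(1) ge_one_powr_ge_zero[of r p] mult_left_mono[of 1 "r powr p" "\<bar>c\<bar>"] by (simp add: powr_mult)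
    finally have n: "n \<le> A * r powr p"
      by (simp add: A_def algebra_simps)
    have rp: "r powr p \<ge> 1"
      using r p(1) by (intro ge_one_powr_ge_zero) auto
    have "1 * 1 \<le> A * r powr p"
      using rp \<open>A \<ge> 1\<close> by (intro mult_mono) auto
    then have "ln_plus n \<le> ln (A * r powr p)"
      using n unfolding ln_plus_def by (subst ln_le_cancel_iff) auto
    also have "\<dots> = ln A + p * x"
      using \<open>A \<ge> 1\<close> r by (simp add: ln_mult ln_powr x_def)
    finally have lnn: "ln_plus n \<le> ln A + p * x" .
    have "growth_exponent 2 f r \<le> (2 powr p * r powr p) / sqrt r + (A * r powr p) / sqrt r * x powr 2 * (ln A + p * x)"
      unfolding growth_exponent_def n_def[symmetric] x_def[symmetric]
    proof (intro add_mono mult_mono divide_right_mono n lnn ln_plus_nonneg)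
      show "nevanlinna_T (2 * r) f \<le> 2 powr p * r powr p"
        using elim(1) r by (simp add: powr_mult)
    qed (use r \<open>A \<ge> 1\<close> in \<open>auto simp: n_def\<close>)
    also have "\<dots> = r powr p / sqrt r * (2 powr p + A * (ln A * x powr 2 + p * (x powr 2 * x)))"
      by (simp add: add_divide_distrib algebra_simps)
    finally have G: "growth_exponent 2 f r \<le> r powr p / sqrt r * (2 powr p + A * (ln A * x powr 2 + p * (x powr 2 * x)))" .
    have "B * growth_exponent 2 f r \<le> \<bar>B\<bar> * growth_exponent 2 f r"
      using growth_exponent_nonneg[of 2 r] r by (intro mult_right_mono) auto
    also have "\<dots> \<le> \<bar>B\<bar> * (r powr p / sqrt r * (2 powr p + A * (ln A * x powr 2 + p * (x powr 2 * x))))"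
      using G by (intro mult_left_mono) auto
    also have "\<dots> = r powr p / sqrt r * (r powr (\<epsilon> / 2) * (\<bar>B\<bar> * (2 powr p * (1 / r powr (\<epsilon> / 2)) + A * (ln A * (x powr 2 / r powr (\<epsilon> / 2))
       + p * (x powr 2 * x / r powr (\<epsilon> / 2))))))"
      using r by (simp add: distrib_left mult_ac)
    also have "\<dots> \<le> r powr p / sqrt r * (r powr (\<epsilon> / 2) * 1)"
      using elim(3) r unfolding x_def by (intro mult_left_mono) auto
    also have "\<dots> = r powr (p + \<epsilon> / 2 - 1 / 2)"
      using r by (simp add: powr_add powr_diff powr_half_sqrt)
    also have "p + \<epsilon> / 2 - 1 / 2 = \<sigma> - 1 / 2 + \<epsilon>"
      by (simp add: p_def)
    finally show ?case .
  qed
qed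

lemma rcis_eq_square: "r \<ge> 0 \<Longrightarrow> rcis r \<theta> = (rcis (sqrt r) (\<theta> / 2))\<^sup>2"
  by (simp add: power2_eq_square rcis_mult)

section \<open>The two estimates for the Wilson operator\<close>

text \<open>Two shifts, by 1/2 and -1/2, are needed. The additive 1 in the exponent costs a factor
  e, and for r >= 4 the division by |z| = sqrt r >= 2 brings it down to e / 2 <= 2.\<close>

lemma AE_wilson_ratio_le:
  assumes "\<gamma> > 1"
  obtains B where "\<And>f. nonzero_meromorphic f \<Longrightarrow> AE \<theta> in lebesgue. \<theta> \<in> {-pi..<pi} \<longrightarrow>
     (\<forall>\<^sub>F r in at_top. norm (wilson f (rcis r \<theta>) / f (rcis r \<theta>)) \<le> 2 * exp (B * growth_exponent \<gamma> f r))"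
proof -
  obtain B where B: "\<And>f. nonzero_meromorphic f \<Longrightarrow>
    AE \<theta> in lborel. \<bar>\<theta>\<bar> \<le> pi \<longrightarrow> (\<forall>\<^sub>F r in at_top. f (rcis r \<theta>) \<noteq> 0 \<and>
      (\<forall>s\<in>{1 / 2, - 1 / 2}. norm (f ((rcis (sqrt r) (\<theta> / 2) + \<i> * of_real s)\<^sup>2))
          \<le> exp (1 + B * growth_exponent \<gamma> f r) * norm (f (rcis r \<theta>))))"
    by (rule AE_shifted_square_ratio_le[OF assms, of "{1 / 2, - 1 / 2}"]) auto
  show thesis
  proof (rule that[of B])
    fix f assume f: "nonzero_meromorphic f"
    show "AE \<theta> in lebesgue. \<theta> \<in> {-pi..<pi} \<longrightarrow>
     (\<forall>\<^sub>F r in at_top. norm (wilson f (rcis r \<theta>) / f (rcis r \<theta>)) \<le> 2 * exp (B * growth_exponent \<gamma> f r))"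
      using AE_completion[OF B[OF f]]
    proof eventually_elim
      case (elim \<theta>)
      show ?case
      proof
        assume "\<theta> \<in> {-pi..<pi}"
        then have "\<bar>\<theta>\<bar> \<le> pi"
          by auto
        with elim have ev: "\<forall>\<^sub>F r in at_top. f (rcis r \<theta>) \<noteq> 0 \<and>
          (\<forall>s\<in>{1 / 2, - 1 / 2}. norm (f ((rcis (sqrt r) (\<theta> / 2) + \<i> * of_real s)\<^sup>2))
          \<le> exp (1 + B * growth_exponent \<gamma> f r) * norm (f (rcis r \<theta>)))"
          by blast
        have "\<forall>\<^sub>F r :: real in at_top. r \<ge> 4"
          by (rule eventually_ge_at_top)
        with ev show "\<forall>\<^sub>F r in at_top. norm (wilson f (rcis r \<theta>) / f (rcis r \<theta>)) \<le> 2 * exp (B * growth_exponent \<gamma> f r)"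
        proof eventually_elim
          case (elim r)
          define z where "z = rcis (sqrt r) (\<theta> / 2)"
          define v where "v = norm (f (rcis r \<theta>))"
          define E where "E = exp (B * growth_exponent \<gamma> f r)"
          have v: "v > 0"
            using elim(1) by (simp add: v_def)
          have nz: "norm z = sqrt r"
            using elim(2) by (simp add: z_def)
          have "norm (wilson f (z\<^sup>2)) \<le> (exp 1 * E * v) / norm z"
            using elim by (intro norm_wilson_le) (auto simp: z_def v_def E_def exp_add)
          also have "\<dots> \<le> (exp 1 * E * v) / 2"
            unfolding nz using elim(2) real_sqrt_le_mono[of 4 r] v
            by (intro divide_left_mono) (auto simp: E_def)
          also have "\<dots> \<le> (3 * E * v) / 2"
            using exp_le v by (intro divide_right_mono mult_right_mono) (auto simp: E_def)
          also have "\<dots> \<le> 2 * E * v"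
            using v by (simp add: E_def)
          finally have "norm (wilson f (z\<^sup>2)) / v \<le> 2 * E"
            using v by (simp add: field_simps)
          then have "norm (wilson f (z\<^sup>2) / f (rcis r \<theta>)) \<le> 2 * E"
            by (simp add: norm_divide flip: v_def)
          moreover have "z\<^sup>2 = rcis r \<theta>"
            unfolding z_def using elim(2) by (intro rcis_eq_square[symmetric]) simp
          ultimately show ?case
            by (simp only: E_def)
        qed
      qed
    qed
  qed
qed

text \<open>The comparison is made with \<gamma> = 2 and the shifts j / 2 for |j| <= k, so only the
  order of f itself enters. The factor e is cancelled by the single division by sqrt r >= e.\<close>

lemma AE_wilson_funpow_ratio_le:
  assumes f: "nonzero_meromorphic f" and ord: "growth_order f = ereal \<sigma>" and "k \<ge> 1" "\<epsilon> > 0"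
  shows "AE \<theta> in lebesgue. \<theta> \<in> {-pi..<pi} \<longrightarrow> (\<forall>\<^sub>F r in at_top.
     norm ((wilson ^^ k) f (rcis r \<theta>) / f (rcis r \<theta>)) \<le> exp (real k * r powr (\<sigma> - 1 / 2 + \<epsilon>)))"
proof -
  define S where "S = (\<lambda>j::int. real_of_int j / 2) ` {- int k..int k}"
  obtain B where B: "\<And>f. nonzero_meromorphic f \<Longrightarrow>
    AE \<theta> in lborel. \<bar>\<theta>\<bar> \<le> pi \<longrightarrow> (\<forall>\<^sub>F r in at_top. f (rcis r \<theta>) \<noteq> 0 \<and>
      (\<forall>s\<in>S. norm (f ((rcis (sqrt r) (\<theta> / 2) + \<i> * of_real s)\<^sup>2))
          \<le> exp (1 + B * growth_exponent 2 f r) * norm (f (rcis r \<theta>))))"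
    by (rule AE_shifted_square_ratio_le[of 2 S]) (auto simp: S_def)
  show ?thesis
    using AE_completion[OF B[OF f]]
  proof eventually_elim
    case (elim \<theta>)
    show ?case
    proof
      assume "\<theta> \<in> {-pi..<pi}"
      then have "\<bar>\<theta>\<bar> \<le> pi"
        by auto
      with elim have ev: "\<forall>\<^sub>F r in at_top. f (rcis r \<theta>) \<noteq> 0 \<and>
        (\<forall>s\<in>S. norm (f ((rcis (sqrt r) (\<theta> / 2) + \<i> * of_real s)\<^sup>2))
          \<le> exp (1 + B * growth_exponent 2 f r) * norm (f (rcis r \<theta>)))"
        by blast
      have ev2: "\<forall>\<^sub>F r in at_top. sqrt r \<ge> real k + 1" "\<forall>\<^sub>F r :: real in at_top. sqrt r \<ge> exp 1"
        "\<forall>\<^sub>F r :: real in at_top. r > 0"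
        by real_asymp+
      show "\<forall>\<^sub>F r in at_top. norm ((wilson ^^ k) f (rcis r \<theta>) / f (rcis r \<theta>)) \<le> exp (real k * r powr (\<sigma> - 1 / 2 + \<epsilon>))"
        using ev ev2 eventually_growth_exponent_le[OF f ord \<open>\<epsilon> > 0\<close>, of B]
      proof eventually_elim
        case (elim r)
        define z where "z = rcis (sqrt r) (\<theta> / 2)"
        define v where "v = norm (f (rcis r \<theta>))"
        define E where "E = exp (B * growth_exponent 2 f r)"
        have v: "v > 0"
          using elim(1) by (simp add: v_def)
        have nz: "norm z = sqrt r"
          using elim(4) by (simp add: z_def)
        have "norm ((wilson ^^ k) f (z\<^sup>2)) \<le> (exp 1 * E * v) / norm z"
        proof (rule norm_wilson_funpow_le[OF \<open>k \<ge> 1\<close>])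
          show "norm (f ((z + \<i> * of_real (real_of_int j / 2))\<^sup>2)) \<le> exp 1 * E * v" if "\<bar>j\<bar> \<le> int k" for j
          proof -
            have "real_of_int j / 2 \<in> S"
              unfolding S_def by (rule imageI) (use that in auto)
            then show ?thesis
              using elim(1) unfolding z_def v_def E_def exp_add[symmetric] by blast
          qed
        qed (use elim(2) nz in simp)
        also have "\<dots> = exp 1 / sqrt r * (E * v)"
          by (simp add: nz)
        also have "\<dots> \<le> 1 * (E * v)"
          using elim(3,4) v by (intro mult_right_mono) (auto simp: E_def)
        finally have "norm ((wilson ^^ k) f (z\<^sup>2)) / v \<le> E"
          using v by (simp add: field_simps)
        also have "E \<le> exp (real k * r powr (\<sigma> - 1 / 2 + \<epsilon>))"
        proof -
          have "1 * r powr (\<sigma> - 1 / 2 + \<epsilon>) \<le> real k * r powr (\<sigma> - 1 / 2 + \<epsilon>)"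
            using \<open>k \<ge> 1\<close> by (intro mult_right_mono) auto
          then show ?thesis
            unfolding E_def exp_le_cancel_iff using elim(5) by linarith
        qed
        finally have "norm ((wilson ^^ k) f (z\<^sup>2) / f (rcis r \<theta>)) \<le> exp (real k * r powr (\<sigma> - 1 / 2 + \<epsilon>))"
          by (simp add: norm_divide flip: v_def)
        moreover have "z\<^sup>2 = rcis r \<theta>"
          unfolding z_def using elim(4) by (intro rcis_eq_square[symmetric]) simp
        ultimately show ?case
          by (simp only:)
      qed
    qed
  qed
qed

theorem theorem7p5:
  shows "(\<forall>\<gamma>::real. \<gamma> > 1 \<longrightarrow> (\<exists>B::real. \<forall>f :: complex \<Rightarrow> complex.
            f nicely_meromorphic_on UNIV \<and> f \<noteq> (\<lambda>_. 0) \<longrightarrow>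
            (AE \<theta> in lebesgue. \<theta> \<in> {-pi..<pi} \<longrightarrow>
              (\<forall>\<^sub>F r :: real in at_top.
                 norm (wilson f (rcis r \<theta>) / f (rcis r \<theta>))
                   \<le> 2 * exp (B * (nevanlinna_T (\<gamma> * r) f / sqrt r
                        + real (zero_pole_count (\<gamma> * r) f) / sqrt r * (ln r powr \<gamma>)
                            * ln_plus (real (zero_pole_count (\<gamma> * r) f))))))))
       \<and> (\<forall>(f :: complex \<Rightarrow> complex) (\<sigma>::real).
            f nicely_meromorphic_on UNIV \<and> f \<noteq> (\<lambda>_. 0) \<and> growth_order f = ereal \<sigma> \<longrightarrow>
            (\<forall>(k::nat) (\<epsilon>::real). k \<ge> 1 \<and> \<epsilon> > 0 \<longrightarrow>
              (AE \<theta> in lebesgue. \<theta> \<in> {-pi..<pi} \<longrightarrow>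
                (\<forall>\<^sub>F r :: real in at_top.
                   norm ((wilson ^^ k) f (rcis r \<theta>) / f (rcis r \<theta>))
                     \<le> exp (real k * r powr (\<sigma> - 1 / 2 + \<epsilon>))))))"
proof (intro conjI allI impI; (elim conjE)?)
  fix \<gamma> :: real assume "\<gamma> > 1"
  then obtain B where B: "\<And>f. nonzero_meromorphic f \<Longrightarrow> AE \<theta> in lebesgue. \<theta> \<in> {-pi..<pi} \<longrightarrow>
     (\<forall>\<^sub>F r in at_top. norm (wilson f (rcis r \<theta>) / f (rcis r \<theta>)) \<le> 2 * exp (B * growth_exponent \<gamma> f r))"
    by (rule AE_wilson_ratio_le) blast
  then show "\<exists>B::real. \<forall>f :: complex \<Rightarrow> complex.
            f nicely_meromorphic_on UNIV \<and> f \<noteq> (\<lambda>_. 0) \<longrightarrow>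
            (AE \<theta> in lebesgue. \<theta> \<in> {-pi..<pi} \<longrightarrow>
              (\<forall>\<^sub>F r :: real in at_top.
                 norm (wilson f (rcis r \<theta>) / f (rcis r \<theta>))
                   \<le> 2 * exp (B * (nevanlinna_T (\<gamma> * r) f / sqrt r
                        + real (zero_pole_count (\<gamma> * r) f) / sqrt r * (ln r powr \<gamma>)
                            * ln_plus (real (zero_pole_count (\<gamma> * r) f))))))"
    unfolding growth_exponent_def nonzero_meromorphic_def by blast
next
  fix f :: "complex \<Rightarrow> complex" and \<sigma> \<epsilon> :: real and k :: nat
  assume "f nicely_meromorphic_on UNIV" "f \<noteq> (\<lambda>_. 0)" "growth_order f = ereal \<sigma>" "k \<ge> 1" "\<epsilon> > 0"
  then show "AE \<theta> in lebesgue. \<theta> \<in> {-pi..<pi} \<longrightarrow>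
              (\<forall>\<^sub>F r :: real in at_top.
                 norm ((wilson ^^ k) f (rcis r \<theta>) / f (rcis r \<theta>))
                   \<le> exp (real k * r powr (\<sigma> - 1 / 2 + \<epsilon>)))"
    by (intro AE_wilson_funpow_ratio_le nonzero_meromorphic.intro)
qed

end
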